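(* The map $\theta$ defined below is a bijection from the set of pairs $(t,\tau)$, with $t$ a plane rooted tree with $n$ vertices and $\tau$ a binary tubing of $t$, to the set of rooted connected chord diagrams with $n$ chords.
   Context: A plane rooted tree is a root with an ordered list of plane rooted trees as children. A tube is a vertex set inducing a connected subgraph; a binary tubing $\tau$ of $t$ is a set of tubes containing $V(t)$ such that each tube is a single vertex or is partitioned by two other tubes of $\tau$. If $t$ has $\ge2$ vertices, the two tubes partitioning $V(t)$ are the vertex set of a rooted subtree $t'$ (some non-root vertex and all its descendants) and of $t''=t\setminus t'$ (containing the root); $\tau$ restricts to tubings $\tau',\tau''$ of $t',t''$, and $\tau$ is determined by $(\tau',\tau'')$ and the position where $t'$ is attached. Rooted tree insertion places (RTIPs) of a plane rooted tree: at each vertex, a place before the first child, between consecutive children, and after the last child (a leaf has one). They are ordered recursively: for root with subtrees $t_1,\dots,t_k$: the place before $t_1$, then the places of $t_1$ in order, the place between $t_1,t_2$, the places of $t_2$, ..., the place after $t_k$. Let $x_i$ be the $i$-th RTIP; $t$ is obtained from $t''$ by attaching the root of $t'$ as a child at some RTIP $x_i$ of $t''$. A rooted chord diagram of size $n$ is a set of pairs $(a_j,b_j)$, $a_j<b_j$, partitioning $\{1,\dots,2n\}$; the root chord is the one with $a_j=1$. Two chords $(a,b),(a',b')$ cross if $a<a'<b<b'$ or $a'<a<b'<b$; a diagram is connected if its crossing graph is connected. Definition of $\theta$: if $t$ is one vertex, $\theta(\tau)$ is the one-chord diagram. Otherwise let $C''=\theta(\tau'')$ (size $n''$) and $C'=\theta(\tau')$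 (size $m$, root chord $(1,k)$), and let $i$ be such that $t'$ is attached at the $i$-th RTIP of $t''$. Then $\theta(\tau)$ has points $\{1,\dots,2n''+2m\}$ and chords: $(1,k+i)$; $(a+i,b+i)$ for each non-root chord $(a,b)$ of $C'$; and for each chord of $C''$, each endpoint $p$ becomes $p+1$ if $p\le i$ and $p+2m$ if $p>i$.
   Formalization: The tubes of a binary tubing are also required to be pairwise nested or disjoint; without this, all six tubes of the 3-vertex path would qualify, the two tubes partitioning V(t) would not be unique, and θ would be undefined. *)

theory Defs
  imports Main "HOL-Library.Disjoint_Sets"
begin

definition connected_graph :: "'v set \<Rightarrow> ('v \<times> 'v) set \<Rightarrow> bool" where
  "connected_graph V E \<longleftrightarrow>
     V \<noteq> {} \<and> (\<forall>u\<in>V. \<forall>v\<in>V. (u, v) \<in> ((E \<union> E\<inverse>) \<inter> V \<times> V)\<^sup>*)"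

datatype plane_tree = Root "plane_tree list"

text \<open>A plane rooted tree whose vertices carry names. Subtrees keep the names of their vertices,
  so a tubing is restricted to a subtree by selecting the tubes contained in it.\<close>

datatype 'v vtree = Node (root: 'v) (children: "'v vtree list")

fun verts :: "'v vtree \<Rightarrow> 'v set" where
  "verts (Node v ts) = insert v (\<Union>s\<in>set ts. verts s)"

fun edges :: "'v vtree \<Rightarrow> ('v \<times> 'v) set" where
  "edges (Node v ts) = {(v, root s) | s. s \<in> set ts} \<union> (\<Union>s\<in>set ts. edges s)"

text \<open>The canonical naming of the vertices of a plane rooted tree: a vertex is named by the list
  of child positions (counted from 0) leading to it from the root.\<close>

fun named_from :: "nat list \<Rightarrow> plane_tree \<Rightarrow> nat list vtree"
  and named_forest :: "nat list \<Rightarrow> nat \<Rightarrow> plane_tree list \<Rightarrow> nat list vtree list" where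
  "named_from p (Root ts) = Node p (named_forest p 0 ts)"
| "named_forest p j [] = []"
| "named_forest p j (t # ts) = named_from (p @ [j]) t # named_forest p (Suc j) ts"

definition named :: "plane_tree \<Rightarrow> nat list vtree" where
  "named t = named_from [] t"

definition tube :: "'v vtree \<Rightarrow> 'v set \<Rightarrow> bool" where
  "tube t S \<longleftrightarrow> S \<subseteq> verts t \<and> connected_graph S (edges t)"

text \<open>As usual for tubings, tubes are nested or disjoint. This has to be required separately: on
  the path with vertices 1, 2, 3 the set of all six tubes satisfies the remaining conditions, but
  there the tubes partitioning the vertex set are not unique.\<close>

definition binary_tubing :: "'v vtree \<Rightarrow> 'v set set \<Rightarrow> bool" where
  "binary_tubing t \<tau> \<longleftrightarrow>
     (\<forall>S\<in>\<tau>. tube t S) \<and>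
     verts t \<in> \<tau> \<and>
     (\<forall>A\<in>\<tau>. \<forall>B\<in>\<tau>. A \<subseteq> B \<or> B \<subseteq> A \<or> A \<inter> B = {}) \<and>
     (\<forall>S\<in>\<tau>. (\<exists>v. S = {v}) \<or>
        (\<exists>A\<in>\<tau>. \<exists>B\<in>\<tau>. A \<noteq> S \<and> B \<noteq> S \<and> partition_on S {A, B}))"

definition tubing_restrict :: "'v set set \<Rightarrow> 'v vtree \<Rightarrow> 'v set set" where
  "tubing_restrict \<tau> s = {S \<in> \<tau>. S \<subseteq> verts s}"

text \<open>The ordered list of rooted tree insertion places; the pair \<open>(v, j)\<close> is the place at the
  vertex \<open>v\<close> that is preceded by exactly \<open>j\<close> children of \<open>v\<close>.\<close>

fun rtips :: "'v vtree \<Rightarrow> ('v \<times> nat) list"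
  and rtips_from :: "'v \<Rightarrow> nat \<Rightarrow> 'v vtree list \<Rightarrow> ('v \<times> nat) list" where
  "rtips (Node v ts) = rtips_from v 0 ts"
| "rtips_from v j [] = [(v, j)]"
| "rtips_from v j (s # ss) = (v, j) # rtips s @ rtips_from v (Suc j) ss"

fun attach :: "'v vtree \<Rightarrow> 'v \<times> nat \<Rightarrow> 'v vtree \<Rightarrow> 'v vtree" where
  "attach t' (w, j) (Node v ts) =
     Node v (if v = w then take j ts @ t' # drop j ts else map (attach t' (w, j)) ts)"

text \<open>The insertion places are counted from 1.\<close>

definition tubing_split ::
  "'v vtree \<Rightarrow> 'v set set \<Rightarrow> 'v vtree \<Rightarrow> 'v vtree \<Rightarrow> nat \<Rightarrow> bool" where
  "tubing_split t \<tau> t' t'' i \<longleftrightarrow>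
     i \<in> {1..length (rtips t'')} \<and> t = attach t' (rtips t'' ! (i - 1)) t'' \<and>
     verts t' \<in> \<tau> \<and> verts t'' \<in> \<tau>"

definition insert_diagram ::
  "nat \<Rightarrow> (nat \<times> nat) set \<Rightarrow> (nat \<times> nat) set \<Rightarrow> (nat \<times> nat) set" where
  "insert_diagram i C' C'' =
     (let m = card C'; k = (THE k. (1, k) \<in> C');
          f = (\<lambda>p. if p \<le> i then p + 1 else p + 2 * m)
      in {(1, k + i)} \<union> {(a + i, b + i) | a b. (a, b) \<in> C' - {(1, k)}}
         \<union> {(f a, f b) | a b. (a, b) \<in> C''})"

lemma rtips_verts:
  "x \<in> set (rtips t) \<Longrightarrow> fst x \<in> verts t"
  "x \<in> set (rtips_from v j ss) \<Longrightarrow> fst x \<in> insert v (\<Union>s\<in>set ss. verts s)"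
  by (induction t and v j ss rule: rtips_rtips_from.induct) auto

lemma size_list_take_drop: "size_list f (take j xs) + size_list f (drop j xs) = size_list f xs"
  by (metis append_take_drop_id size_list_append)

lemma size_attach_ge: "size s \<le> size (attach t' x s)"
proof (induction t' x s rule: attach.induct)
  case (1 t' w j v ts)
  have "size_list size ts \<le> size_list (\<lambda>s. size (attach t' (w, j) s)) ts" if "v \<noteq> w"
    using 1 that by (intro size_list_pointwise) auto
  then show ?case
    using size_list_take_drop[of size j ts] by (auto simp: size_list_map o_def)
qed

lemma size_attach: "fst x \<in> verts s \<Longrightarrow> size t' + size s < size (attach t' x s)"
proof (induction t' x s rule: attach.induct)
  case (1 t' w j v ts)
  show ?case
  proof (cases "v = w")
    case True
    then show ?thesis using size_list_take_drop[of size j ts] by simp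
  next
    case False
    with 1 obtain s where s: "s \<in> set ts" "w \<in> verts s" by auto
    then obtain us vs where ts: "ts = us @ s # vs" by (meson split_list)
    have "size t' + size s < size (attach t' (w, j) s)" using 1 False s by simp
    moreover have "size_list size xs \<le> size_list (\<lambda>s. size (attach t' (w, j) s)) xs" for xs
      by (intro size_list_pointwise size_attach_ge)
    from this[of us] this[of vs] calculation show ?thesis
      using False by (simp add: ts size_list_map o_def)
  qed
qed

lemma size_tubing_split:
  assumes "tubing_split t \<tau> t' t'' i"
  shows "size t' < size t" "size t'' < size t"
proof -
  have "rtips t'' ! (i - 1) \<in> set (rtips t'')"
    using assms by (intro nth_mem) (auto simp: tubing_split_def)
  from size_attach[OF rtips_verts(1)[OF this]] have "size t' + size t'' < size t"
    using assms unfolding tubing_split_def by metis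
  then show "size t' < size t" "size t'' < size t" by auto
qed

text \<open>For a binary tubing of a tree with distinctly named vertices the triple chosen here is
  unique; the last branch is never reached.\<close>

function theta_named :: "'v vtree \<Rightarrow> 'v set set \<Rightarrow> (nat \<times> nat) set" where
  "theta_named t \<tau> =
     (if children t = [] then {(1, 2)}
      else if \<exists>t' t'' i. tubing_split t \<tau> t' t'' i then
        (case (SOME (t', t'', i). tubing_split t \<tau> t' t'' i) of (t', t'', i) \<Rightarrow>
           insert_diagram i
             (theta_named t' (tubing_restrict \<tau> t'))
             (theta_named t'' (tubing_restrict \<tau> t'')))
      else undefined)"
  by pat_completeness auto
termination
proof (relation "measure (\<lambda>(t, \<tau>). size t)", simp, goal_cases)
  case (1 t \<tau> t' q t'' i)
  then have "tubing_split t \<tau> t' t'' i"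
    using someI_ex[of "\<lambda>(t', t'', i). tubing_split t \<tau> t' t'' i"] by auto
  then show ?case by (auto dest: size_tubing_split)
next
  case (2 t \<tau> t' q t'' i)
  then have "tubing_split t \<tau> t' t'' i"
    using someI_ex[of "\<lambda>(t', t'', i). tubing_split t \<tau> t' t'' i"] by auto
  then show ?case by (auto dest: size_tubing_split)
qed

declare theta_named.simps [simp del]

definition theta :: "plane_tree \<Rightarrow> nat list set set \<Rightarrow> (nat \<times> nat) set" where
  "theta t \<tau> = theta_named (named t) \<tau>"

definition chord_diagram :: "nat \<Rightarrow> (nat \<times> nat) set \<Rightarrow> bool" where
  "chord_diagram n C \<longleftrightarrow>
     (\<forall>(a, b)\<in>C. a < b) \<and> partition_on {1..2 * n} ((\<lambda>(a, b). {a, b}) ` C)"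

definition crosses :: "nat \<times> nat \<Rightarrow> nat \<times> nat \<Rightarrow> bool" where
  "crosses c d \<longleftrightarrow>
     (case (c, d) of ((a, b), (a', b')) \<Rightarrow>
        a < a' \<and> a' < b \<and> b < b' \<or> a' < a \<and> a < b' \<and> b' < b)"

definition connected_diagram :: "(nat \<times> nat) set \<Rightarrow> bool" where
  "connected_diagram C \<longleftrightarrow> connected_graph C {(c, d). crosses c d}"

end

theory Submission
  imports Defs "HOL-Library.Multiset"
begin

text \<open>
  Both sides are generated by the same recursion. On the tree side, the two tubes that partition
  \<open>V(t)\<close> are connected, so one of them is a full rooted subtree \<open>t'\<close> and \<open>t\<close> arises from
  \<open>t''\<close> by grafting \<open>t'\<close> at one of its \<open>2n'' - 1\<close> insertion places; up to renaming vertices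
  a tubing is the same thing as a triple \<open>(i, \<tau>', \<tau>'')\<close>. On the diagram side, remove the root chord \<open>(1, r)\<close> from a
  connected diagram with at least two chords and let \<open>L\<close> be the component of the chord starting at
  2. No other chord crosses \<open>L\<close>, and since the whole diagram is connected all remaining endpoints lie
  in the same gap between consecutive endpoints of \<open>L\<close> as \<open>r\<close>. Hence the diagram is obtained in
  exactly one way by inserting a connected diagram \<open>C'\<close> (the root chord and the chords outside \<open>L\<close>)
  into an inner gap of a connected diagram \<open>C''\<close> (the chords of \<open>L\<close>).
\<close>

section \<open>Connectedness via closed subsets\<close>

text \<open>The function \<open>theta_named\<close> picks its split with \<open>SOME\<close> and
  passes to subtrees that keep their old names, so the smaller trees are in general not canonically
  named even when \<open>t\<close> is. The inductions on tubings therefore run over trees with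
  arbitrary distinct names, through the relation \<open>tubing_diagram\<close>, which involves no
  choice and is invariant under injective renaming. Canonical names enter only at the end: equal
  shapes give the same named tree, and a renaming that maps a plane tree to itself fixes every
  vertex, so uniqueness up to renaming becomes equality. The number 2n'' - 1 has two origins that
  have to agree. A vertex with d children has d + 1 places, which sums to (n'' - 1) + n''; and 2n''
  points on a line have 2n'' - 1 gaps between consecutive points. The two outer gaps are excluded
  because an insertion there would leave the chords of \<open>C''\<close> uncrossed by those of
  \<open>C'\<close>.\<close>

lemma connected_graph_iff_closed:
  "connected_graph V E \<longleftrightarrow> V \<noteq> {} \<and>
     (\<forall>S\<subseteq>V. S \<noteq> {} \<longrightarrow> (\<forall>u\<in>S. \<forall>v\<in>V. (u, v) \<in> E \<or> (v, u) \<in> E \<longrightarrow> v \<in> S) \<longrightarrow> S = V)"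
  (is "_ \<longleftrightarrow> _ \<and> ?closed")
proof -
  define R where "R = (E \<union> E\<inverse>) \<inter> V \<times> V"
  have conn_def: "connected_graph V E \<longleftrightarrow> V \<noteq> {} \<and> (\<forall>u\<in>V. \<forall>v\<in>V. (u, v) \<in> R\<^sup>*)"
    unfolding connected_graph_def R_def ..
  have closed: ?closed if conn: "\<forall>u\<in>V. \<forall>v\<in>V. (u, v) \<in> R\<^sup>*"
  proof (intro allI impI)
    fix S assume S: "S \<subseteq> V" "S \<noteq> {}"
      and cl: "\<forall>u\<in>S. \<forall>v\<in>V. (u, v) \<in> E \<or> (v, u) \<in> E \<longrightarrow> v \<in> S"
    from S obtain u where u: "u \<in> S" by blast
    have "v \<in> S" if "(u, v) \<in> R\<^sup>*" for v
      using that
    proof (induction rule: rtrancl_induct)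
      case (step x y)
      then have "y \<in> V" "(x, y) \<in> E \<or> (y, x) \<in> E" by (auto simp: R_def)
      with step cl show ?case by blast
    qed (rule u)
    with conn S(1) u show "S = V" by (metis subsetD subsetI subset_antisym)
  qed
  have conn: "(u, v) \<in> R\<^sup>*" if cl: ?closed and uv: "u \<in> V" "v \<in> V" for u v
  proof -
    define S where "S = {w \<in> V. (u, w) \<in> R\<^sup>*}"
    have "\<forall>x\<in>S. \<forall>y\<in>V. (x, y) \<in> E \<or> (y, x) \<in> E \<longrightarrow> y \<in> S"
    proof (intro ballI impI)
      fix x y assume x: "x \<in> S" and y: "y \<in> V" and "(x, y) \<in> E \<or> (y, x) \<in> E"
      then have "(x, y) \<in> R" by (auto simp: R_def S_def)
      with x y show "y \<in> S" unfolding S_def using rtrancl_into_rtrancl[of u x R y] by blast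
    qed
    moreover have "S \<subseteq> V" "S \<noteq> {}" using uv by (auto simp: S_def)
    ultimately have "S = V" by (intro cl[rule_format]) blast+
    then show ?thesis using uv(2) S_def by blast
  qed
  show ?thesis
  proof
    assume "connected_graph V E"
    then have "V \<noteq> {}" and c: "\<forall>u\<in>V. \<forall>v\<in>V. (u, v) \<in> R\<^sup>*" unfolding conn_def by auto
    from this(1) closed[OF c] show "V \<noteq> {} \<and> ?closed" by (rule conjI)
  next
    assume a: "V \<noteq> {} \<and> ?closed"
    show "connected_graph V E"
      unfolding conn_def
      by (intro conjI ballI conjunct1[OF a]) (rule conn[OF conjunct2[OF a]])
  qed
qed

text \<open>The usual application: collect the vertices that have some property, check that it
  passes along edges, and conclude that every vertex has it. This replaces inductions along
  paths.\<close>

lemma connected_graph_closedD: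
  assumes "connected_graph V E" "S \<subseteq> V" "S \<noteq> {}"
    "\<And>u v. u \<in> S \<Longrightarrow> v \<in> V \<Longrightarrow> (u, v) \<in> E \<or> (v, u) \<in> E \<Longrightarrow> v \<in> S"
  shows "S = V"
  by (rule assms(1)[unfolded connected_graph_iff_closed, THEN conjunct2, rule_format, OF assms(2,3)])
    (rule assms(4))

lemma connected_graphI_closed:
  assumes "V \<noteq> {}"
    "\<And>S. S \<subseteq> V \<Longrightarrow> S \<noteq> {} \<Longrightarrow>
       (\<And>u v. u \<in> S \<Longrightarrow> v \<in> V \<Longrightarrow> (u, v) \<in> E \<or> (v, u) \<in> E \<Longrightarrow> v \<in> S) \<Longrightarrow> V \<subseteq> S"
  shows "connected_graph V E"
  unfolding connected_graph_iff_closed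
proof (intro conjI allI impI)
  fix S assume S: "S \<subseteq> V" "S \<noteq> {}"
    and cl: "\<forall>u\<in>S. \<forall>v\<in>V. (u, v) \<in> E \<or> (v, u) \<in> E \<longrightarrow> v \<in> S"
  show "S = V" by (rule subset_antisym[OF S(1) assms(2)[OF S cl[rule_format]]])
qed (rule assms(1))

lemma connected_graph_cong:
  assumes "\<And>u v. u \<in> V \<Longrightarrow> v \<in> V \<Longrightarrow> (u, v) \<in> E \<longleftrightarrow> (u, v) \<in> F"
  shows "connected_graph V E \<longleftrightarrow> connected_graph V F"
proof -
  have "(E \<union> E\<inverse>) \<inter> V \<times> V = (F \<union> F\<inverse>) \<inter> V \<times> V" using assms by auto
  then show ?thesis unfolding connected_graph_def by simp
qed

text \<open>A closed set contains all or nothing of each part, and the joining edge carries it from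
  one part to the other.\<close>

lemma connected_graph_Un:
  assumes "connected_graph V E" "connected_graph W E" "u \<in> V" "w \<in> W" "(u, w) \<in> E \<or> (w, u) \<in> E"
  shows "connected_graph (V \<union> W) E"
proof (rule connected_graphI_closed)
  show "V \<union> W \<noteq> {}" using assms by auto
  fix S assume S: "S \<subseteq> V \<union> W" "S \<noteq> {}"
    and cl: "\<And>u v. u \<in> S \<Longrightarrow> v \<in> V \<union> W \<Longrightarrow> (u, v) \<in> E \<or> (v, u) \<in> E \<Longrightarrow> v \<in> S"
  have V: "S \<inter> V = {} \<or> V \<subseteq> S"
    using connected_graph_closedD[OF assms(1), of "S \<inter> V"] cl by blast
  have W: "S \<inter> W = {} \<or> W \<subseteq> S"
    using connected_graph_closedD[OF assms(2), of "S \<inter> W"] cl by blast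
  show "V \<union> W \<subseteq> S"
    using V W S cl[of u w] cl[of w u] assms(3-5) by blast
qed

text \<open>The preimage of a closed set is closed.\<close>

lemma connected_graph_image:
  assumes "connected_graph V E" "\<And>u v. u \<in> V \<Longrightarrow> v \<in> V \<Longrightarrow> (u, v) \<in> E \<Longrightarrow> (h u, h v) \<in> F"
  shows "connected_graph (h ` V) F"
proof (rule connected_graphI_closed)
  show "h ` V \<noteq> {}" using assms(1) by (simp add: connected_graph_def)
  fix S assume S: "S \<subseteq> h ` V" "S \<noteq> {}"
    and cl: "\<And>u v. u \<in> S \<Longrightarrow> v \<in> h ` V \<Longrightarrow> (u, v) \<in> F \<or> (v, u) \<in> F \<Longrightarrow> v \<in> S"
  have "{v \<in> V. h v \<in> S} = V"
  proof (rule connected_graph_closedD[OF assms(1)])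
    fix u v assume u: "u \<in> {v \<in> V. h v \<in> S}" and v: "v \<in> V" "(u, v) \<in> E \<or> (v, u) \<in> E"
    then have "(h u, h v) \<in> F \<or> (h v, h u) \<in> F" using assms(2) by blast
    then show "v \<in> {v \<in> V. h v \<in> S}" using cl[of "h u" "h v"] u v by blast
  qed (use S in auto)
  then show "h ` V \<subseteq> S" by blast
qed

lemma connected_component_exists:
  assumes "c \<in> V"
  obtains L where "L \<subseteq> V" "c \<in> L" "connected_graph L E"
    "\<And>u v. u \<in> L \<Longrightarrow> v \<in> V \<Longrightarrow> (u, v) \<in> E \<or> (v, u) \<in> E \<Longrightarrow> v \<in> L"
proof -
  define R where "R = (E \<union> E\<inverse>) \<inter> V \<times> V"
  define L where "L = {d. (c, d) \<in> R\<^sup>*}"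
  have "d \<in> V" if "(c, d) \<in> R\<^sup>*" for d
    using that by (induction rule: rtrancl_induct) (use assms in \<open>auto simp: R_def\<close>)
  then have sub: "L \<subseteq> V" by (auto simp: L_def)
  have cl: "v \<in> L" if "u \<in> L" "v \<in> V" "(u, v) \<in> E \<or> (v, u) \<in> E" for u v
  proof -
    have "(u, v) \<in> R" using that sub by (auto simp: R_def)
    then show ?thesis using that(1) rtrancl_into_rtrancl[of c u R v] by (simp add: L_def)
  qed
  have reach: "L \<subseteq> S" if "c \<in> S"
    and S: "\<And>u v. u \<in> S \<Longrightarrow> v \<in> L \<Longrightarrow> (u, v) \<in> E \<or> (v, u) \<in> E \<Longrightarrow> v \<in> S" for S
  proof
    fix d assume "d \<in> L"
    then have "(c, d) \<in> R\<^sup>*" by (simp add: L_def)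
    then show "d \<in> S"
    proof (induction rule: rtrancl_induct)
      case (step u v)
      then have "v \<in> L" using rtrancl_into_rtrancl[of c u R v] by (simp add: L_def)
      moreover have "(u, v) \<in> E \<or> (v, u) \<in> E" using step by (auto simp: R_def)
      ultimately show ?case using S step by blast
    qed (rule \<open>c \<in> S\<close>)
  qed
  have c: "c \<in> L" by (simp add: L_def)
  have "connected_graph L E"
  proof (rule connected_graphI_closed)
    fix S assume S: "S \<subseteq> L" "S \<noteq> {}"
      and clS: "\<And>u v. u \<in> S \<Longrightarrow> v \<in> L \<Longrightarrow> (u, v) \<in> E \<or> (v, u) \<in> E \<Longrightarrow> v \<in> S"
    show "L \<subseteq> S"
    proof (cases "c \<in> S")
      case True
      then show ?thesis using reach clS by blast
    next
      case False
      \<comment> \<open>Adjacency is symmetric, so the complement of a closed set is closed. Here it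
        contains \<open>c\<close>, hence all of \<open>L\<close>, and \<open>S\<close> would be
        empty.\<close>
      have "L \<subseteq> L - S"
      proof (rule reach)
        fix u v assume "u \<in> L - S" "v \<in> L" "(u, v) \<in> E \<or> (v, u) \<in> E"
        then show "v \<in> L - S" using clS[of v u] by blast
      qed (use False c in auto)
      then show ?thesis using S by blast
    qed
  qed (use c in auto)
  then show thesis using that sub c cl by blast
qed

section \<open>Grafting named trees\<close>

text \<open>Unlike \<open>verts\<close>, the list records repetitions:
  \<open>distinct (preorder t)\<close> says that the vertices have distinct names, and its length
  counts vertices.\<close>

fun preorder :: "'v vtree \<Rightarrow> 'v list" where
  "preorder (Node v ts) = v # concat (map preorder ts)"

lemma set_preorder [simp]: "set (preorder t) = verts t"
  by (induction t) auto

lemma root_in_verts [simp]: "root t \<in> verts t"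
  by (cases t) auto

lemma verts_nonempty [simp]: "verts t \<noteq> {}"
  by (cases t) auto

lemma card_verts: "distinct (preorder t) \<Longrightarrow> card (verts t) = length (preorder t)"
  by (metis distinct_card set_preorder)

lemma preorder_map: "preorder (map_vtree f t) = map f (preorder t)"
  by (induction t) (auto simp: map_concat intro!: arg_cong[where f = concat])

lemma verts_map: "verts (map_vtree f t) = f ` verts t"
  by (metis preorder_map set_map set_preorder)

lemma map_vtree_cong_verts: "(\<And>v. v \<in> verts t \<Longrightarrow> f v = g v) \<Longrightarrow> map_vtree f t = map_vtree g t"
  by (induction t) auto

lemma edges_subset_verts: "(x, y) \<in> edges t \<Longrightarrow> x \<in> verts t \<and> y \<in> verts t"
  by (induction t) (auto, (metis root_in_verts)+)

text \<open>A vertex with d children contributes d + 1 places, and the numbers of children add up to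
  the number of vertices minus one.\<close>

lemma length_rtips:
  fixes t :: "'v vtree" and ts :: "'v vtree list"
  shows
  "length (rtips t) = 2 * length (preorder t) - 1"
  "length (rtips_from v j ts) = 2 * length (concat (map preorder ts)) + 1"
proof (induction t and v j ts rule: rtips_rtips_from.induct)
  case (3 v j s ss)
  have "length (preorder s) > 0" by (cases s) auto
  with 3 show ?case by simp
qed auto

lemma rtips_map:
  fixes t :: "'v vtree" and ts :: "'v vtree list"
  shows
  "rtips (map_vtree f t) = map (map_prod f id) (rtips t)"
  "rtips_from (f v) j (map (map_vtree f) ts) = map (map_prod f id) (rtips_from v j ts)"
  by (induction t and v j ts rule: rtips_rtips_from.induct) auto

lemma set_rtips_from:
  "set (rtips_from v j ts) = {(v, j + k) | k. k \<le> length ts} \<union> (\<Union>s\<in>set ts. set (rtips s))"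
proof (induction ts arbitrary: j)
  case (Cons s ss)
  have "{(v, j + k) | k. k \<le> Suc (length ss)} =
      insert (v, j) {(v, Suc j + k) | k. k \<le> length ss}" (is "?L = ?R")
  proof
    show "?L \<subseteq> ?R"
    proof
      fix x assume "x \<in> ?L"
      then obtain k where "x = (v, j + k)" "k \<le> Suc (length ss)" by auto
      then show "x \<in> ?R" by (cases k) auto
    qed
    show "?R \<subseteq> ?L" by (auto intro: exI[of _ 0] exI[of _ "Suc _"])
  qed
  then show ?case using Cons by auto
qed auto

lemma set_rtips_Node:
  "set (rtips (Node v ts)) = {(v, k) | k. k \<le> length ts} \<union> (\<Union>s\<in>set ts. set (rtips s))"
  by (simp add: set_rtips_from)

text \<open>Makes the index of a place recoverable from the place itself. Places at different
  vertices differ by name, those at one vertex by the number of preceding children.\<close>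

lemma distinct_rtips:
  fixes t :: "'v vtree" and ts :: "'v vtree list"
  shows
  "distinct (preorder t) \<Longrightarrow> distinct (rtips t)"
  "distinct (v # concat (map preorder ts)) \<Longrightarrow> distinct (rtips_from v j ts)"
proof (induction t and v j ts rule: rtips_rtips_from.induct)
  case (3 v j s ss)
  have "(v, j) \<notin> set (rtips s)" using rtips_verts(1)[of "(v, j)" s] 3(3) by auto
  moreover have "(v, j) \<notin> set (rtips_from v (Suc j) ss)"
    using rtips_verts(1)[of "(v, j)"] 3(3) by (auto simp: set_rtips_from)
  moreover have "x \<notin> set (rtips_from v (Suc j) ss)" if "x \<in> set (rtips s)" for x
    using rtips_verts(1)[OF that] rtips_verts(2)[of x v "Suc j" ss] 3(3) by auto
  ultimately show ?case using 3 by auto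
qed auto

text \<open>A relational form of \<open>attach\<close>. It names the siblings to the left and right
  along a single path down to the place, whereas \<open>attach\<close> searches all children for a
  name; this allows induction and inversion on where the graft happens.\<close>

inductive grafts :: "'v vtree \<Rightarrow> 'v \<times> nat \<Rightarrow> 'v vtree \<Rightarrow> 'v vtree \<Rightarrow> bool" for t' where
  grafts_root: "grafts t' (v, length us) (Node v (us @ vs)) (Node v (us @ t' # vs))"
| grafts_child: "grafts t' x s'' s \<Longrightarrow>
    grafts t' x (Node v (us @ s'' # vs)) (Node v (us @ s # vs))"

text \<open>Where the new vertices appear in the preorder list depends on the place, so only the
  multisets can be compared. Distinctness, vertex sets and sizes all follow from it.\<close>

lemma mset_preorder_grafts:
  "grafts t' x t'' t \<Longrightarrow> mset (preorder t) = mset (preorder t' @ preorder t'')"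
  by (induction rule: grafts.induct) auto

lemma distinct_grafts_iff:
  "grafts t' x t'' t \<Longrightarrow> distinct (preorder t) \<longleftrightarrow> distinct (preorder t' @ preorder t'')"
  by (metis mset_preorder_grafts mset_eq_imp_distinct_iff)

lemma verts_grafts: "grafts t' x t'' t \<Longrightarrow> verts t = verts t' \<union> verts t''"
  by (metis mset_preorder_grafts mset_eq_setD set_append set_preorder)

lemma length_preorder_grafts:
  "grafts t' x t'' t \<Longrightarrow> length (preorder t) = length (preorder t') + length (preorder t'')"
  by (metis mset_preorder_grafts mset_eq_length length_append)

lemma root_grafts: "grafts t' x t'' t \<Longrightarrow> root t = root t''"
  by (induction rule: grafts.induct) auto

lemma children_grafts: "grafts t' x t'' t \<Longrightarrow> children t \<noteq> []"
  by (induction rule: grafts.induct) auto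

lemma grafts_in_rtips: "grafts t' x t'' t \<Longrightarrow> x \<in> set (rtips t'')"
  by (induction rule: grafts.induct) (auto simp: set_rtips_from)

lemma grafts_map:
  "grafts t' x t'' t \<Longrightarrow>
    grafts (map_vtree f t') (map_prod f id x) (map_vtree f t'') (map_vtree f t)"
proof (induction rule: grafts.induct)
  case (grafts_root v us vs)
  show ?case using grafts.grafts_root[of "map_vtree f t'" "f v" "map (map_vtree f) us"] by simp
next
  case (grafts_child x s'' s v us vs)
  then show ?case by (auto intro: grafts.grafts_child)
qed

lemma edges_grafts:
  "grafts t' x t'' t \<Longrightarrow> edges t = insert (fst x, root t') (edges t' \<union> edges t'')"
proof (induction rule: grafts.induct)
  case (grafts_child x s'' s v us vs)
  \<comment> \<open>Stated for any tree in the position of the changed child. Grafting preserves its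
    root, so the edge from \<open>v\<close> down to it is the same before and after.\<close>
  have "edges (Node v (us @ s # vs)) = {(v, root u) | u. u \<in> set us \<union> set vs} \<union>
      {(v, root s)} \<union> (\<Union>u\<in>set us \<union> set vs. edges u) \<union> edges s" for s
    by auto
  from this[of s] this[of s''] show ?case
    using grafts_child.IH root_grafts[OF grafts_child.hyps] by (simp del: edges.simps) blast
qed auto

section \<open>Agreement of \<open>attach\<close> with the grafting relation\<close>

lemma attach_outside: "fst x \<notin> verts t \<Longrightarrow> attach t' x t = t"
  by (induction t' x t rule: attach.induct) (auto intro: map_idI)

lemma grafts_attach: "x \<in> set (rtips t'') \<Longrightarrow> distinct (preorder t'') \<Longrightarrow> grafts t' x t'' (attach t' x t'')"
proof (induction t' x t'' rule: attach.induct)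
  case (1 t' w j v ts)
  show ?case
  proof (cases "v = w")
    case True
    \<comment> \<open>A place deeper down would repeat the name \<open>w\<close>. So the place
      belongs to the root, which bounds \<open>j\<close> by the number of children.\<close>
    have "(w, j) \<notin> set (rtips s)" if "s \<in> set ts" for s
      using rtips_verts(1)[of "(w, j)" s] that 1(3) True by auto
    then have "j \<le> length ts" using 1(2) unfolding set_rtips_Node by auto
    then have "grafts t' (w, j) (Node v (take j ts @ drop j ts)) (Node v (take j ts @ t' # drop j ts))"
      using grafts_root[of t' v "take j ts" "drop j ts"] True by simp
    then show ?thesis using True by simp
  next
    case False
    then obtain s where s: "s \<in> set ts" "(w, j) \<in> set (rtips s)"
      using 1(2) unfolding set_rtips_Node by auto
    then obtain us vs where ts: "ts = us @ s # vs" by (meson split_list)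
    have w: "w \<in> verts s" using rtips_verts(1)[OF s(2)] by simp
    have "attach t' (w, j) u = u" if "u \<in> set us \<union> set vs" for u
      using that w 1(3) by (intro attach_outside) (auto simp: ts)
    then have "map (attach t' (w, j)) ts = us @ attach t' (w, j) s # vs"
      unfolding ts by (auto intro!: map_idI)
    moreover have "grafts t' (w, j) s (attach t' (w, j) s)"
      using 1 False s by (auto simp: ts)
    ultimately show ?thesis using False grafts_child by (fastforce simp: ts)
  qed
qed

lemma attach_eq_of_grafts: "grafts t' x t'' t \<Longrightarrow> distinct (preorder t'') \<Longrightarrow> t = attach t' x t''"
proof (induction rule: grafts.induct)
  case (grafts_child x s'' s v us vs)
  have w: "fst x \<in> verts s''" using grafts_in_rtips[OF grafts_child(1)] rtips_verts(1) by blast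
  have "attach t' x u = u" if "u \<in> set us \<union> set vs" for u
    using that w grafts_child.prems by (intro attach_outside) auto
  then have "map (attach t' x) (us @ s'' # vs) = us @ s # vs"
    using grafts_child by (auto intro!: map_idI)
  moreover have "v \<noteq> fst x" using w grafts_child.prems by auto
  ultimately show ?case by (cases x) simp
qed simp

text \<open>Distinct names make siblings disjoint, so a common vertex forces two selected children
  to be the same occurrence. This aligns two decompositions of one child list.\<close>

lemma same_position:
  assumes "us @ a # vs = us' @ b # vs'" "distinct (concat (map preorder (us @ a # vs)))"
    "verts a \<inter> verts b \<noteq> {}"
  shows "us = us' \<and> a = b \<and> vs = vs'"
  using assms
proof (induction us arbitrary: us')
  case Nil
  then show ?case by (cases us') auto
next
  case (Cons u us)
  then show ?case by (cases us') auto
qed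

text \<open>Both derivations must follow the same path, since the vertex set locates the grafted
  tree. If one stopped at the root and the other went into a child, one grafted tree would have
  strictly more vertices than the other.\<close>

lemma grafts_inj:
  assumes "grafts t' x t'' t" "grafts s' y s'' t" "distinct (preorder t)" "verts t' = verts s'"
  shows "t' = s' \<and> x = y \<and> t'' = s''"
  using assms
proof (induction arbitrary: s'' rule: grafts.induct)
  case (grafts_root v us vs)
  from grafts_root(1) show ?case
  proof cases
    case (grafts_root us' vs')
    then show ?thesis using same_position[of us t' vs us' s' vs'] grafts_root.prems by auto
  next
    case (grafts_child u'' u us' vs')
    have V: "verts u = verts s' \<union> verts u''" using grafts_child by (simp add: verts_grafts)
    then have "us = us' \<and> t' = u \<and> vs = vs'"
      using same_position[of us t' vs us' u vs'] grafts_root.prems grafts_child by auto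
    moreover have "verts s' \<inter> verts u'' = {}"
      using distinct_grafts_iff[OF grafts_child(3)] grafts_root.prems calculation by auto
    ultimately show ?thesis using V grafts_root.prems verts_nonempty[of u''] by blast
  qed
next
  case IH: (grafts_child x u'' u v us vs)
  have V: "verts u = verts t' \<union> verts u''" using IH by (simp add: verts_grafts)
  from IH(3) show ?case
  proof cases
    case (grafts_root us' vs')
    then have "us = us' \<and> s' = u \<and> vs = vs'"
      using same_position[of us u vs us' s' vs'] IH.prems V by auto
    moreover have "verts t' \<inter> verts u'' = {}"
      using distinct_grafts_iff[OF IH(1)] IH.prems calculation by auto
    ultimately show ?thesis using V IH.prems verts_nonempty[of u''] by blast
  next
    case (grafts_child w'' w us' vs')
    have "verts w = verts s' \<union> verts w''" using grafts_child by (simp add: verts_grafts)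
    then have "verts u \<inter> verts w \<noteq> {}" using V IH.prems(3) verts_nonempty[of t'] by blast
    then have "us = us' \<and> u = w \<and> vs = vs'"
      using same_position[of us u vs us' w vs'] IH.prems(2) grafts_child by simp
    then show ?thesis using IH.IH[of w''] IH.prems grafts_child by auto
  qed
qed

text \<open>The only edge between a child subtree and the rest of the tree joins \<open>v\<close> to
  the root of that subtree. All propagation arguments in the splitting of trees rest on
  this.\<close>

lemma edges_child:
  assumes "distinct (preorder (Node v (us @ s # vs)))" "(x, y) \<in> edges (Node v (us @ s # vs))"
  shows "x \<in> verts s \<Longrightarrow> (x, y) \<in> edges s"
    and "y \<in> verts s \<Longrightarrow> (x, y) \<in> edges s \<or> (x = v \<and> y = root s)"
proof -
  have v: "v \<notin> verts s" using assms by auto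
  have disj: "verts s \<inter> verts u = {}" if "u \<in> set us \<union> set vs" for u
    using assms(1) that by auto
  consider "x = v" "y = root s" | u where "u \<in> set us \<union> set vs" "x = v" "y = root u"
    | "(x, y) \<in> edges s" | u where "u \<in> set us \<union> set vs" "(x, y) \<in> edges u"
    using assms(2) by auto
  then have "(x \<in> verts s \<longrightarrow> (x, y) \<in> edges s) \<and>
      (y \<in> verts s \<longrightarrow> (x, y) \<in> edges s \<or> (x = v \<and> y = root s))"
  proof cases
    case (2 u)
    then show ?thesis using v disj[of u] root_in_verts[of u] by blast
  next
    case (4 u)
    then show ?thesis using disj[of u] edges_subset_verts[of x y u] by blast
  qed (use v in auto)
  then show "x \<in> verts s \<Longrightarrow> (x, y) \<in> edges s"
    "y \<in> verts s \<Longrightarrow> (x, y) \<in> edges s \<or> (x = v \<and> y = root s)" by auto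
qed

text \<open>Follow the root downwards. The part \<open>A\<close> avoids the root and is connected,
  so it sits inside one child subtree \<open>s\<close>. Either it contains the root of
  \<open>s\<close> and is all of \<open>s\<close>, or the same situation recurs in \<open>s\<close>
  with \<open>B\<close> cut down to it.\<close>

lemma grafts_of_connected_partition:
  assumes "distinct (preorder t)" "A \<union> B = verts t" "A \<inter> B = {}" "root t \<in> B"
    "connected_graph A (edges t)" "connected_graph B (edges t)"
  shows "\<exists>t' x t''. grafts t' x t'' t \<and> verts t' = A \<and> verts t'' = B"
  using assms
proof (induction t arbitrary: B)
  case (Node v ts)
  let ?t = "Node v ts"
  have v: "v \<in> B" "v \<notin> A" using Node.prems by auto
  have "A \<noteq> {}" using Node.prems(5) by (simp add: connected_graph_def)
  then obtain a where "a \<in> A" by blast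
  then obtain s where s: "s \<in> set ts" "a \<in> verts s"
    using Node.prems(2) v by (metis UN_E UnI1 insertE verts.simps)
  then obtain us vs where ts: "ts = us @ s # vs" by (meson split_list)
  note dist = Node.prems(1)[unfolded ts]
  note edge = edges_child[OF dist, folded ts]
  have vs: "v \<notin> verts s" using dist by auto
  have sub: "edges s \<subseteq> edges ?t" "verts s \<subseteq> verts ?t" using s by auto
  have "A \<inter> verts s = A"
  proof (rule connected_graph_closedD[OF Node.prems(5)])
    fix x y assume "x \<in> A \<inter> verts s" "y \<in> A" "(x, y) \<in> edges ?t \<or> (y, x) \<in> edges ?t"
    then show "y \<in> A \<inter> verts s" using edge v edges_subset_verts[of _ _ s] by blast
  qed (use s \<open>a \<in> A\<close> in auto)
  then have A: "A \<subseteq> verts s" by blast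
  show ?case
  proof (cases "root s \<in> A")
    case True
    \<comment> \<open>The only way into \<open>s\<close> is through its root, which belongs to
      \<open>A\<close>; hence \<open>B\<close> cannot enter \<open>s\<close>.\<close>
    have "B - verts s = B"
    proof (rule connected_graph_closedD[OF Node.prems(6)])
      fix x y assume "x \<in> B - verts s" "y \<in> B" "(x, y) \<in> edges ?t \<or> (y, x) \<in> edges ?t"
      then show "y \<in> B - verts s"
        using edge v edges_subset_verts[of _ _ s] True Node.prems(3) by blast
    qed (use vs v in auto)
    then have As: "A = verts s" using A sub(2) Node.prems(2) by blast
    moreover have g: "grafts s (v, length us) (Node v (us @ vs)) ?t" unfolding ts by (rule grafts_root)
    moreover have "verts s \<inter> verts (Node v (us @ vs)) = {}" using dist by auto
    ultimately have "verts (Node v (us @ vs)) = B"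
      using verts_grafts[OF g] Node.prems(2,3) by blast
    then show ?thesis using g As by blast
  next
    case False
    then have rs: "root s \<in> B" using Node.prems(2) sub(2) root_in_verts[of s] by blast
    let ?B = "B \<inter> verts s"
    have connA: "connected_graph A (edges s)"
      using connected_graph_cong[of A "edges ?t" "edges s"] A edge sub Node.prems(5) by blast
    have connB: "connected_graph ?B (edges s)"
    proof (rule connected_graphI_closed)
      show "?B \<noteq> {}" using rs by auto
      fix S assume S: "S \<subseteq> ?B" "S \<noteq> {}" and
        cl: "\<And>x y. x \<in> S \<Longrightarrow> y \<in> ?B \<Longrightarrow> (x, y) \<in> edges s \<or> (y, x) \<in> edges s \<Longrightarrow> y \<in> S"
      have "root s \<in> S"
      proof (rule ccontr)
        assume r: "root s \<notin> S"
        \<comment> \<open>Without the root of \<open>s\<close> there is no exit from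
          \<open>s\<close>, so \<open>S\<close> would be closed in all of \<open>B\<close>, which
          contains \<open>v\<close>.\<close>
        have "S = B"
        proof (rule connected_graph_closedD[OF Node.prems(6)])
          fix x y assume "x \<in> S" "y \<in> B" "(x, y) \<in> edges ?t \<or> (y, x) \<in> edges ?t"
          then show "y \<in> S" using edge cl[of x y] S r edges_subset_verts[of _ _ s] by blast
        qed (use S in auto)
        then show False using v vs S by blast
      qed
      \<comment> \<open>Since \<open>S\<close> contains the root of \<open>s\<close>, adding
        everything of \<open>B\<close> outside \<open>s\<close> gives a closed set.\<close>
      have "S \<union> (B - verts s) = B"
      proof (rule connected_graph_closedD[OF Node.prems(6)])
        fix x y assume "x \<in> S \<union> (B - verts s)" "y \<in> B" "(x, y) \<in> edges ?t \<or> (y, x) \<in> edges ?t"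
        then show "y \<in> S \<union> (B - verts s)"
          using edge cl[of x y] S \<open>root s \<in> S\<close> edges_subset_verts[of _ _ s] by blast
      qed (use S in auto)
      then show "?B \<subseteq> S" by blast
    qed
    have "\<exists>t' x s''. grafts t' x s'' s \<and> verts t' = A \<and> verts s'' = ?B"
    proof (rule Node.IH[OF s(1) _ _ _ _ connA connB])
      show "A \<union> ?B = verts s" using A sub(2) Node.prems(2) by blast
    qed (use dist rs Node.prems(3) in auto)
    then obtain t' x s'' where g: "grafts t' x s'' s" "verts t' = A" "verts s'' = ?B" by blast
    then have g': "grafts t' x (Node v (us @ s'' # vs)) ?t" unfolding ts by (auto intro: grafts_child)
    have "verts t' \<inter> verts (Node v (us @ s'' # vs)) = {}"
      using distinct_grafts_iff[OF g'] Node.prems(1) by auto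
    then have "verts (Node v (us @ s'' # vs)) = B"
      using verts_grafts[OF g'] g(2) Node.prems(2,3) by blast
    then show ?thesis using g' g by blast
  qed
qed

section \<open>Chord diagrams\<close>

text \<open>Turns an order-theoretic description of endpoints into an explicit interval whose length
  is a cardinality; it computes the positions of the two parts of a diagram.\<close>

lemma downset_interval:
  fixes A :: "nat set"
  assumes "finite A" "\<And>x. x \<in> A \<Longrightarrow> k \<le> x" "\<And>x y. x \<in> A \<Longrightarrow> k \<le> y \<Longrightarrow> y < x \<Longrightarrow> y \<in> A"
  shows "A = {k..<k + card A}"
proof (cases "A = {}")
  case False
  then have M: "Max A \<in> A" using assms(1) by simp
  have A: "A = {k..Max A}"
  proof
    show "A \<subseteq> {k..Max A}" using assms(1,2) by auto
    show "{k..Max A} \<subseteq> A"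
    proof
      fix x assume "x \<in> {k..Max A}"
      then show "x \<in> A" using assms(3)[OF M, of x] M by (cases "x = Max A") auto
    qed
  qed
  have "card A = Suc (Max A) - k" by (subst A) simp
  then have "{k..<k + card A} = {k..Max A}" using assms(2)[OF M] by auto
  with A show ?thesis by simp
qed auto

section \<open>Matchings on arbitrary points\<close>

definition ends :: "'a \<times> 'a \<Rightarrow> 'a set" where
  "ends c = {fst c, snd c}"

definition points :: "('a \<times> 'a) set \<Rightarrow> 'a set" where
  "points C = (\<Union>c\<in>C. ends c)"

text \<open>A chord diagram without the demand that its points be an initial segment, so that sets
  of chords cut out of a diagram are objects of the same kind.\<close>

definition matching :: "('a::linorder \<times> 'a) set \<Rightarrow> bool" where
  "matching C \<longleftrightarrow> (\<forall>c\<in>C. fst c < snd c) \<and> (\<forall>c\<in>C. \<forall>d\<in>C. c \<noteq> d \<longrightarrow> ends c \<inter> ends d = {})"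

lemma in_points: "c \<in> C \<Longrightarrow> fst c \<in> points C" "c \<in> C \<Longrightarrow> snd c \<in> points C"
  by (auto simp: points_def ends_def)

lemma subset_points_times: "C \<subseteq> points C \<times> points C"
  using in_points by (fastforce simp: mem_Times_iff)

lemma points_obtain:
  assumes "p \<in> points C"
  obtains c where "c \<in> C" "p = fst c \<or> p = snd c"
  using assms by (auto simp: points_def ends_def)

lemma points_Un [simp]: "points (C \<union> D) = points C \<union> points D"
  by (auto simp: points_def)

lemma points_image: "points (map_prod h h ` C) = h ` points C"
  by (auto simp: points_def ends_def image_UN)

lemma matching_less: "matching C \<Longrightarrow> c \<in> C \<Longrightarrow> fst c < snd c"
  by (auto simp: matching_def)

lemma matching_eqI: "matching C \<Longrightarrow> c \<in> C \<Longrightarrow> d \<in> C \<Longrightarrow> p \<in> ends c \<Longrightarrow> p \<in> ends d \<Longrightarrow> c = d"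
  by (auto simp: matching_def)

lemma matching_subset: "matching C \<Longrightarrow> D \<subseteq> C \<Longrightarrow> matching D"
  unfolding matching_def by blast

lemma matching_Un:
  "matching C \<Longrightarrow> matching D \<Longrightarrow> points C \<inter> points D = {} \<Longrightarrow> matching (C \<union> D)"
  unfolding matching_def points_def by blast

lemma points_Diff:
  assumes "matching C" "D \<subseteq> C"
  shows "points (C - D) = points C - points D"
proof -
  have "points (C - D) \<inter> points D = {}"
    unfolding points_def using assms(2) matching_eqI[OF assms(1)] by blast
  moreover have "points C = points (C - D) \<union> points D"
    using assms(2) by (metis points_Un Un_Diff_cancel2 sup.absorb1)
  ultimately show ?thesis by blast
qed

lemma matching_image:
  assumes "matching C" "strict_mono_on (points C) h"
  shows "matching (map_prod h h ` C)"
proof -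
  have inj: "inj_on h (points C)" using assms(2) strict_mono_on_imp_inj_on by blast
  have "fst (map_prod h h c) < snd (map_prod h h c)" if "c \<in> C" for c
    using strict_mono_onD[OF assms(2)] in_points[OF that] matching_less[OF assms(1) that] by simp
  moreover have "ends (map_prod h h c) \<inter> ends (map_prod h h d) = {}"
    if "c \<in> C" "d \<in> C" "map_prod h h c \<noteq> map_prod h h d" for c d
  proof -
    have "c \<noteq> d" using that(3) by blast
    then have "ends c \<inter> ends d = {}" using assms(1) that(1,2) unfolding matching_def by blast
    then show ?thesis
      using inj_onD[OF inj] in_points[OF that(1)] in_points[OF that(2)] by (auto simp: ends_def)
  qed
  ultimately show ?thesis unfolding matching_def
    by (intro conjI ballI impI; elim imageE; simp only:)
qed

lemma card_points:
  assumes "matching C" "finite C"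
  shows "card (points C) = 2 * card C"
proof -
  have "card (points C) = (\<Sum>c\<in>C. card (ends c))"
    unfolding points_def using assms
    by (intro card_UN_disjoint) (auto simp: matching_def ends_def)
  also have "\<dots> = (\<Sum>c\<in>C. 2)"
    using matching_less[OF assms(1)] by (intro sum.cong) (simp_all add: ends_def less_imp_neq)
  finally show ?thesis by simp
qed

lemma chord_diagram_iff: "chord_diagram n C \<longleftrightarrow> matching C \<and> points C = {1..2 * n}"
proof -
  have ends: "(\<lambda>(a, b). {a, b}) = (ends :: nat \<times> nat \<Rightarrow> nat set)"
    by (auto simp: ends_def)
  have lt: "(\<forall>(a, b)\<in>C. a < b) \<longleftrightarrow> (\<forall>c\<in>C. fst c < snd c)" by auto
  \<comment> \<open>Disjointness in the library compares different sets, \<open>matching\<close>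
    compares different chords. The two agree because an ordered chord is determined by its set of
    ends.\<close>
  have disj: "disjoint (ends ` C) \<longleftrightarrow> (\<forall>c\<in>C. \<forall>d\<in>C. c \<noteq> d \<longrightarrow> ends c \<inter> ends d = {})"
    if lt: "\<forall>c\<in>C. fst c < snd c"
  proof -
    have inj: "ends c = ends d \<longleftrightarrow> c = d" if "c \<in> C" "d \<in> C" for c d
    proof -
      have "fst c < snd c" "fst d < snd d" using lt that by auto
      then show ?thesis by (auto simp: ends_def doubleton_eq_iff prod_eq_iff)
    qed
    have "disjoint (ends ` C) \<longleftrightarrow> (\<forall>c\<in>C. \<forall>d\<in>C. ends c \<noteq> ends d \<longrightarrow> ends c \<inter> ends d = {})"
      by (simp add: disjoint_def)
    then show ?thesis using inj by simp
  qed
  have "{} \<notin> ends ` C" by (auto simp: ends_def)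
  then have iff: "chord_diagram n C \<longleftrightarrow> (\<forall>c\<in>C. fst c < snd c) \<and> points C = {1..2 * n} \<and> disjoint (ends ` C)"
    unfolding chord_diagram_def ends lt partition_on_def points_def by simp
  show ?thesis
  proof (cases "\<forall>c\<in>C. fst c < snd c")
    case True
    show ?thesis unfolding iff matching_def disj[OF True] by (rule iffI; elim conjE; intro conjI)
  next
    case False
    then show ?thesis unfolding iff matching_def by (simp only: simp_thms)
  qed
qed

lemma chord_diagram_finite: "chord_diagram n C \<Longrightarrow> finite C"
  using subset_points_times[of C] unfolding chord_diagram_iff
  by (metis finite_SigmaI finite_atLeastAtMost finite_subset)

lemma chord_diagram_card: "chord_diagram n C \<Longrightarrow> card C = n"
  using card_points[of C] chord_diagram_finite[of n C] by (auto simp: chord_diagram_iff)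

section \<open>Crossings, connectedness and the root chord\<close>

lemma crosses_iff:
  "crosses c d \<longleftrightarrow> fst c < fst d \<and> fst d < snd c \<and> snd c < snd d \<or>
     fst d < fst c \<and> fst c < snd d \<and> snd d < snd c"
  by (auto simp: crosses_def split: prod.splits)

lemma crosses_sym: "crosses c d \<Longrightarrow> crosses d c"
  by (auto simp: crosses_iff)

lemma crosses_image:
  assumes "strict_mono_on (points C) h" "c \<in> C" "d \<in> C" "crosses c d"
  shows "crosses (map_prod h h c) (map_prod h h d)"
  using assms(4) strict_mono_onD[OF assms(1)] in_points[OF assms(2)] in_points[OF assms(3)]
  by (auto simp: crosses_iff)

lemma connected_diagram_image:
  assumes "connected_diagram C" "strict_mono_on (points C) h"
  shows "connected_diagram (map_prod h h ` C)"
  using assms(1) unfolding connected_diagram_def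
  by (rule connected_graph_image) (use crosses_image[OF assms(2)] in auto)

lemma connected_diagram_closedD:
  assumes "connected_diagram C" "S \<subseteq> C" "S \<noteq> {}"
    "\<And>c d. c \<in> S \<Longrightarrow> d \<in> C \<Longrightarrow> crosses c d \<Longrightarrow> d \<in> S"
  shows "S = C"
  using assms(1) unfolding connected_diagram_def
  by (rule connected_graph_closedD) (use assms(2-) crosses_sym in auto)

lemma connected_diagramI_closed:
  assumes "C \<noteq> {}" "\<And>S. S \<subseteq> C \<Longrightarrow> S \<noteq> {} \<Longrightarrow>
     (\<And>c d. c \<in> S \<Longrightarrow> d \<in> C \<Longrightarrow> crosses c d \<Longrightarrow> d \<in> S) \<Longrightarrow> C \<subseteq> S"
  shows "connected_diagram C"
  unfolding connected_diagram_def
  by (rule connected_graphI_closed) (use assms in auto)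

lemma connected_diagram_nonempty: "connected_diagram C \<Longrightarrow> C \<noteq> {}"
  by (simp add: connected_diagram_def connected_graph_def)

lemma connected_diagram_size_pos: "chord_diagram n C \<Longrightarrow> connected_diagram C \<Longrightarrow> n \<ge> 1"
  using chord_diagram_card[of n C] chord_diagram_finite[of n C] connected_diagram_nonempty[of C]
  by (metis One_nat_def Suc_leI card_gt_0_iff)

lemma chord_diagram_single: "chord_diagram 1 {(1, 2)}"
  by (auto simp: chord_diagram_iff matching_def points_def ends_def)

lemma connected_diagram_single: "connected_diagram {c}"
  by (simp add: connected_diagram_def connected_graph_def)

lemma chord_diagram_one:
  assumes "chord_diagram 1 C"
  shows "C = {(1, 2)}"
proof -
  obtain c where C: "C = {c}" using chord_diagram_card[OF assms] card_1_singletonE by blast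
  then have "fst c < snd c" "{fst c, snd c} = {1..2}"
    using assms by (auto simp: chord_diagram_iff matching_def points_def ends_def)
  moreover have "{1..2} = {1, 2::nat}" by auto
  ultimately have "c = (1, 2)" by (auto simp: doubleton_eq_iff prod_eq_iff)
  then show ?thesis using C by simp
qed

lemma chord_diagram_root:
  assumes "chord_diagram n C" "n \<ge> 1"
  obtains k where "(1, k) \<in> C" "\<And>c. c \<in> C \<Longrightarrow> c \<noteq> (1, k) \<Longrightarrow> 1 < fst c"
proof -
  have m: "matching C" "points C = {1..2 * n}" using assms by (auto simp: chord_diagram_iff)
  have "1 \<in> points C" using m assms(2) by auto
  then obtain c where c: "c \<in> C" "1 = fst c \<or> 1 = snd c" by (rule points_obtain)
  have pos: "1 \<le> fst d" if "d \<in> C" for d using in_points(1)[OF that] m by auto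
  have f: "fst c = 1" using pos[OF c(1)] c matching_less[OF m(1) c(1)] by auto
  show thesis
  proof
    show "(1, snd c) \<in> C" using c f by (metis prod.collapse)
    fix d assume d: "d \<in> C" "d \<noteq> (1, snd c)"
    have "fst d \<noteq> 1"
      using matching_eqI[OF m(1) c(1) d(1), of 1] f d(2) by (auto simp: ends_def prod_eq_iff)
    then show "1 < fst d" using pos[OF d(1)] by simp
  qed
qed

section \<open>Inserting one diagram into another\<close>

text \<open>The second end of the root chord moves by \<open>i\<close> like all other points, so
  keeping only the point 1 fixed unites the two clauses for \<open>C'\<close> in
  \<open>insert_diagram\<close> into one increasing relabelling.\<close>

definition shift_nonroot :: "nat \<Rightarrow> nat \<Rightarrow> nat" where
  "shift_nonroot i p = (if p = 1 then 1 else p + i)"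

text \<open>The shift by 1 makes room for the new first point; beyond \<open>i\<close> there are
  \<open>2 * m - 1\<close> further points, namely the remaining ends of \<open>C'\<close>.\<close>

definition open_gap :: "nat \<Rightarrow> nat \<Rightarrow> nat \<Rightarrow> nat" where
  "open_gap i m p = (if p \<le> i then p + 1 else p + 2 * m)"

lemma strict_mono_on_shift_nonroot: "strict_mono_on {1..n} (shift_nonroot i)"
  by (auto simp: strict_mono_on_def shift_nonroot_def)

lemma strict_mono_on_open_gap: "m \<ge> 1 \<Longrightarrow> strict_mono_on A (open_gap i m)"
  by (auto simp: strict_mono_on_def open_gap_def)

lemma shift_nonroot_image:
  assumes "m \<ge> 1"
  shows "shift_nonroot i ` {1..2 * m} = insert 1 {i + 2..i + 2 * m}"
proof -
  have "p \<in> shift_nonroot i ` {1..2 * m}" if "p \<in> {i + 2..i + 2 * m}" for p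
    using that by (intro image_eqI[of _ _ "p - i"]) (auto simp: shift_nonroot_def)
  moreover have "1 \<in> shift_nonroot i ` {1..2 * m}"
    using assms by (intro image_eqI[of _ _ 1]) (auto simp: shift_nonroot_def)
  ultimately have "insert 1 {i + 2..i + 2 * m} \<subseteq> shift_nonroot i ` {1..2 * m}" by blast
  moreover have "shift_nonroot i ` {1..2 * m} \<subseteq> insert 1 {i + 2..i + 2 * m}"
    by (auto simp: shift_nonroot_def)
  ultimately show ?thesis by blast
qed

lemma open_gap_image:
  assumes "i \<le> n"
  shows "open_gap i m ` {1..n} = {2..i + 1} \<union> {i + 2 * m + 1..n + 2 * m}"
proof -
  have "p \<in> open_gap i m ` {1..n}" if "p \<in> {2..i + 1}" for p
    using that assms by (intro image_eqI[of _ _ "p - 1"]) (auto simp: open_gap_def)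
  moreover have "p \<in> open_gap i m ` {1..n}" if "p \<in> {i + 2 * m + 1..n + 2 * m}" for p
    using that by (intro image_eqI[of _ _ "p - 2 * m"]) (auto simp: open_gap_def)
  ultimately have "{2..i + 1} \<union> {i + 2 * m + 1..n + 2 * m} \<subseteq> open_gap i m ` {1..n}" by blast
  moreover have "open_gap i m ` {1..n} \<subseteq> {2..i + 1} \<union> {i + 2 * m + 1..n + 2 * m}"
    by (auto simp: open_gap_def)
  ultimately show ?thesis by blast
qed

text \<open>As both relabellings are increasing, crossings and connectedness carry over to each part
  at no cost.\<close>

lemma insert_diagram_eq:
  assumes "chord_diagram m C'" "m \<ge> 1"
  shows "insert_diagram i C' C'' =
    map_prod (shift_nonroot i) (shift_nonroot i) ` C' \<union> map_prod (open_gap i m) (open_gap i m) ` C''"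
proof -
  obtain k where k: "(1, k) \<in> C'" "\<And>c. c \<in> C' \<Longrightarrow> c \<noteq> (1, k) \<Longrightarrow> 1 < fst c"
    using chord_diagram_root[OF assms] by blast
  have m: "matching C'" using assms(1) by (simp add: chord_diagram_iff)
  have the: "(THE k. (1, k) \<in> C') = k"
    using k by (intro the_equality) fastforce+
  have "shift_nonroot i k = k + i" using matching_less[OF m k(1)] by (auto simp: shift_nonroot_def)
  moreover have "map_prod (shift_nonroot i) (shift_nonroot i) ` (C' - {(1, k)}) =
      (\<lambda>(a, b). (a + i, b + i)) ` (C' - {(1, k)})"
    using k(2) matching_less[OF m] by (intro image_cong) (fastforce simp: shift_nonroot_def)+
  moreover have "map_prod (shift_nonroot i) (shift_nonroot i) ` C' =
      insert (map_prod (shift_nonroot i) (shift_nonroot i) (1, k))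
        (map_prod (shift_nonroot i) (shift_nonroot i) ` (C' - {(1, k)}))"
    unfolding image_insert[symmetric] insert_Diff[OF k(1)] ..
  ultimately have "map_prod (shift_nonroot i) (shift_nonroot i) ` C' =
      {(1, k + i)} \<union> (\<lambda>(a, b). (a + i, b + i)) ` (C' - {(1, k)})"
    by (simp add: shift_nonroot_def)
  also have "(\<lambda>(a, b). (a + i, b + i)) ` (C' - {(1, k)}) =
      {(a + i, b + i) | a b. (a, b) \<in> C' - {(1, k)}}" by auto
  finally have 1: "map_prod (shift_nonroot i) (shift_nonroot i) ` C' =
      {(1, k + i)} \<union> {(a + i, b + i) | a b. (a, b) \<in> C' - {(1, k)}}" .
  have 2: "map_prod (open_gap i m) (open_gap i m) ` C'' =
      {(open_gap i m a, open_gap i m b) | a b. (a, b) \<in> C''}"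
    by auto
  show ?thesis
    unfolding insert_diagram_def the Let_def chord_diagram_card[OF assms(1)] 1 2
    by (simp only: open_gap_def)
qed

lemma insert_diagram_parts:
  assumes C': "chord_diagram m C'" "connected_diagram C'"
    and C'': "chord_diagram n C''" "connected_diagram C''" and i: "i \<in> {1..2 * n - 1}"
  defines "G \<equiv> map_prod (shift_nonroot i) (shift_nonroot i) ` C'"
    and "F \<equiv> map_prod (open_gap i m) (open_gap i m) ` C''"
  shows "insert_diagram i C' C'' = G \<union> F"
    and "matching G" "points G = insert 1 {i + 2..i + 2 * m}" "connected_diagram G"
    and "matching F" "points F = {2..i + 1} \<union> {i + 2 * m + 1..2 * n + 2 * m}" "connected_diagram F"
proof -
  have m: "m \<ge> 1" using C' connected_diagram_size_pos by blast
  have pts: "points C' = {1..2 * m}" "points C'' = {1..2 * n}"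
    and mat: "matching C'" "matching C''" using C' C'' by (auto simp: chord_diagram_iff)
  note mono = strict_mono_on_shift_nonroot[of "2 * m" i, folded pts(1)]
    strict_mono_on_open_gap[OF m, of "points C''" i]
  show "insert_diagram i C' C'' = G \<union> F"
    unfolding G_def F_def by (rule insert_diagram_eq[OF C'(1) m])
  show "matching G" "connected_diagram G"
    unfolding G_def using mono(1) mat C' by (auto intro: matching_image connected_diagram_image)
  show "matching F" "connected_diagram F"
    unfolding F_def using mono(2) mat C'' by (auto intro: matching_image connected_diagram_image)
  show "points G = insert 1 {i + 2..i + 2 * m}"
    unfolding G_def points_image pts by (rule shift_nonroot_image[OF m])
  show "points F = {2..i + 1} \<union> {i + 2 * m + 1..2 * n + 2 * m}"
    unfolding F_def points_image pts by (rule open_gap_image) (use i in auto)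
qed

text \<open>A chord of \<open>G\<close> that does not start at 1 has both ends in a block of
  consecutive numbers, and no chord of \<open>F\<close> has an end in that block.\<close>

lemma gap_not_crosses:
  assumes "points G \<subseteq> insert 1 {i + 2..i + 2 * m}" "c \<in> G" "fst c \<noteq> 1" "fst c < snd c"
    and "points F \<subseteq> {2..i + 1} \<union> {i + 2 * m + 1..n}" "d \<in> F" "fst d < snd d"
  shows "\<not> crosses c d"
proof -
  have "fst c \<in> {i + 2..i + 2 * m}" "snd c \<in> insert 1 {i + 2..i + 2 * m}"
    "fst d \<in> {2..i + 1} \<union> {i + 2 * m + 1..n}" "snd d \<in> {2..i + 1} \<union> {i + 2 * m + 1..n}"
    using in_points[OF assms(2)] in_points[OF assms(6)] assms by blast+
  then show ?thesis using assms(4,7) by (auto simp: crosses_iff)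
qed

text \<open>Both parts are connected, so a single crossing between them suffices. The new root chord
  ends inside the gap and therefore crosses any chord of \<open>C''\<close> that spans the
  gap.\<close>

lemma insert_diagram_chord_diagram:
  assumes C': "chord_diagram m C'" "connected_diagram C'"
    and C'': "chord_diagram n C''" "connected_diagram C''" and i: "i \<in> {1..2 * n - 1}"
  shows "chord_diagram (m + n) (insert_diagram i C' C'')"
    and "connected_diagram (insert_diagram i C' C'')"
proof -
  have m: "m \<ge> 1" using C' connected_diagram_size_pos by blast
  define G where "G = map_prod (shift_nonroot i) (shift_nonroot i) ` C'"
  define F where "F = map_prod (open_gap i m) (open_gap i m) ` C''"
  note parts = insert_diagram_parts[OF assms, folded G_def F_def]
  have "points G \<inter> points F = {}" unfolding parts using m by auto
  moreover have "points G \<union> points F = {1..2 * (m + n)}" unfolding parts using i m by auto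
  ultimately show "chord_diagram (m + n) (insert_diagram i C' C'')"
    unfolding chord_diagram_iff parts(1) using parts by (simp add: matching_Un)
  have mat: "matching C'" "matching C''" and pts: "points C' = {1..2 * m}" "points C'' = {1..2 * n}"
    using C' C'' by (auto simp: chord_diagram_iff)
  obtain k where k: "(1, k) \<in> C'" using chord_diagram_root[OF C'(1) m] by blast
  have k2: "2 \<le> k" "k \<le> 2 * m" using matching_less[OF mat(1) k] in_points[OF k] pts by auto
  have "\<exists>c\<in>C''. fst c \<le> i \<and> i < snd c"
  proof (rule ccontr)
    assume none: "\<not> ?thesis"
    \<comment> \<open>If no chord spans the gap, a chord starting before it also ends before it, and
      so does every chord that it crosses. Then the last point \<open>2 * n\<close> would be at most
      \<open>i\<close>; this is where the gap has to be inner.\<close>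
    have "{c \<in> C''. fst c \<le> i} = C''"
    proof (rule connected_diagram_closedD[OF C''(2)])
      have "n \<ge> 1" using i by auto
      then obtain k'' where "(1, k'') \<in> C''" using chord_diagram_root[OF C''(1)] by blast
      then have "(1, k'') \<in> {c \<in> C''. fst c \<le> i}" using i by simp
      then show "{c \<in> C''. fst c \<le> i} \<noteq> {}" by blast
    next
      fix c d assume "c \<in> {c \<in> C''. fst c \<le> i}" "d \<in> C''" "crosses c d"
      moreover from this have "snd c \<le> i" using none by auto
      ultimately show "d \<in> {c \<in> C''. fst c \<le> i}" by (auto simp: crosses_iff)
    qed auto
    then have "fst c \<le> i \<and> snd c \<le> i" if "c \<in> C''" for c using that none by auto
    moreover have "2 * n \<in> points C''" using i pts by auto
    then obtain c where "c \<in> C''" "2 * n = fst c \<or> 2 * n = snd c" by (rule points_obtain)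
    ultimately show False using i by fastforce
  qed
  then obtain c where c: "c \<in> C''" "fst c \<le> i" "i < snd c" by blast
  let ?c = "map_prod (open_gap i m) (open_gap i m) c"
  have "(1, k + i) \<in> G" unfolding G_def using k k2
    by (intro image_eqI[of _ _ "(1, k)"]) (auto simp: shift_nonroot_def)
  moreover have "?c \<in> F" unfolding F_def using c by blast
  moreover have "crosses (1, k + i) ?c"
    using c k2 in_points(1)[OF c(1)] pts by (auto simp: crosses_iff open_gap_def)
  ultimately show "connected_diagram (insert_diagram i C' C'')"
    unfolding parts(1) using parts(4,7) unfolding connected_diagram_def
    by (intro connected_graph_Un) auto
qed

text \<open>The point 2 lies in the \<open>F\<close> part of both decompositions, and crossings
  within \<open>F\<^sub>1\<close> cannot leave \<open>F\<^sub>2\<close>: the only chord of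
  \<open>G\<^sub>2\<close> that could cross \<open>F\<^sub>2\<close> starts at 1, which is not a
  point of \<open>F\<^sub>1\<close>.\<close>

lemma insert_diagram_component_subset:
  assumes D: "matching (G\<^sub>1 \<union> F\<^sub>1)" "G\<^sub>1 \<union> F\<^sub>1 = G\<^sub>2 \<union> F\<^sub>2"
    and F\<^sub>1: "points F\<^sub>1 = {2..i\<^sub>1 + 1} \<union> {i\<^sub>1 + 2 * m\<^sub>1 + 1..n\<^sub>1}" "connected_diagram F\<^sub>1" "i\<^sub>1 \<ge> 1"
    and G\<^sub>2: "points G\<^sub>2 = insert 1 {i\<^sub>2 + 2..i\<^sub>2 + 2 * m\<^sub>2}"
    and F\<^sub>2: "points F\<^sub>2 = {2..i\<^sub>2 + 1} \<union> {i\<^sub>2 + 2 * m\<^sub>2 + 1..n\<^sub>2}" "i\<^sub>2 \<ge> 1"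
  shows "F\<^sub>1 \<subseteq> F\<^sub>2"
proof -
  have "F\<^sub>1 \<inter> F\<^sub>2 = F\<^sub>1"
  proof (rule connected_diagram_closedD[OF F\<^sub>1(2)])
    have "2 \<in> points F\<^sub>1" "2 \<in> points F\<^sub>2" unfolding F\<^sub>1 F\<^sub>2 using F\<^sub>1(3) F\<^sub>2(2) by auto
    then obtain c d where "c \<in> F\<^sub>1" "2 \<in> ends c" "d \<in> F\<^sub>2" "2 \<in> ends d"
      unfolding points_def by blast
    moreover from this have "c = d" using D matching_eqI[OF D(1), of c d 2] by blast
    ultimately show "F\<^sub>1 \<inter> F\<^sub>2 \<noteq> {}" by blast
  next
    fix c d assume c: "c \<in> F\<^sub>1 \<inter> F\<^sub>2" and d: "d \<in> F\<^sub>1" and cross: "crosses c d"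
    have "fst d \<noteq> 1" using in_points(1)[OF d] F\<^sub>1(3) unfolding F\<^sub>1(1) by auto
    moreover have "fst c < snd c" "fst d < snd d" using c d matching_less[OF D(1)] by auto
    ultimately have "d \<notin> G\<^sub>2"
      using gap_not_crosses[of G\<^sub>2 i\<^sub>2 m\<^sub>2 d F\<^sub>2 n\<^sub>2 c] c crosses_sym[OF cross] G\<^sub>2 F\<^sub>2 by auto
    then show "d \<in> F\<^sub>1 \<inter> F\<^sub>2" using d D(2) by blast
  qed auto
  then show ?thesis by blast
qed

lemma map_prod_image_inj:
  assumes "map_prod h h ` C = map_prod h h ` D" "inj_on h (points C \<union> points D)"
  shows "C = D"
proof (rule inj_on_image_eq_iff[THEN iffD1, OF _ _ _ assms(1)])
  show "inj_on (map_prod h h) ((points C \<union> points D) \<times> (points C \<union> points D))"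
    using assms(2) by (rule map_prod_inj_on[OF _ assms(2)])
  show "C \<subseteq> (points C \<union> points D) \<times> (points C \<union> points D)"
    "D \<subseteq> (points C \<union> points D) \<times> (points C \<union> points D)"
    using subset_points_times[of C] subset_points_times[of D] by blast+
qed

text \<open>The two \<open>F\<close> parts agree by mutual inclusion, hence so do the
  \<open>G\<close> parts. The number of points of \<open>G\<close> then gives the size
  \<open>m\<close>, the start of its block gives \<open>i\<close>, and the relabellings can be
  undone.\<close>

lemma insert_diagram_inj:
  assumes C': "chord_diagram m C'" "connected_diagram C'"
    and C'': "chord_diagram n C''" "connected_diagram C''" and i: "i \<in> {1..2 * n - 1}"
    and B': "chord_diagram l B'" "connected_diagram B'"
    and B'': "chord_diagram k B''" "connected_diagram B''" and j: "j \<in> {1..2 * k - 1}"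
    and eq: "insert_diagram i C' C'' = insert_diagram j B' B''"
  shows "i = j \<and> C' = B' \<and> C'' = B''"
proof -
  define G\<^sub>1 where "G\<^sub>1 = map_prod (shift_nonroot i) (shift_nonroot i) ` C'"
  define F\<^sub>1 where "F\<^sub>1 = map_prod (open_gap i m) (open_gap i m) ` C''"
  define G\<^sub>2 where "G\<^sub>2 = map_prod (shift_nonroot j) (shift_nonroot j) ` B'"
  define F\<^sub>2 where "F\<^sub>2 = map_prod (open_gap j l) (open_gap j l) ` B''"
  note p1 = insert_diagram_parts[OF C' C'' i, folded G\<^sub>1_def F\<^sub>1_def]
  note p2 = insert_diagram_parts[OF B' B'' j, folded G\<^sub>2_def F\<^sub>2_def]
  have D: "G\<^sub>1 \<union> F\<^sub>1 = G\<^sub>2 \<union> F\<^sub>2" using eq p1(1) p2(1) by simp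
  have m: "m \<ge> 1" "l \<ge> 1" using C' B' connected_diagram_size_pos by blast+
  have mat: "matching (G\<^sub>1 \<union> F\<^sub>1)"
    using insert_diagram_chord_diagram(1)[OF C' C'' i] p1(1) by (simp add: chord_diagram_iff)
  have F: "F\<^sub>1 = F\<^sub>2"
  proof
    show "F\<^sub>1 \<subseteq> F\<^sub>2"
      using insert_diagram_component_subset[OF mat D p1(6,7) _ p2(3,6)] i j by auto
    show "F\<^sub>2 \<subseteq> F\<^sub>1"
      using insert_diagram_component_subset[OF mat[unfolded D] D[symmetric] p2(6,7) _ p1(3,6)] i j
      by auto
  qed
  have "points G\<^sub>1 \<inter> points F\<^sub>1 = {}" unfolding p1 using m by auto
  then have "G\<^sub>1 \<inter> F\<^sub>1 = {}" using in_points(1) by blast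
  moreover have "points G\<^sub>2 \<inter> points F\<^sub>2 = {}" unfolding p2 using m by auto
  then have "G\<^sub>2 \<inter> F\<^sub>2 = {}" using in_points(1) by blast
  ultimately have G: "G\<^sub>1 = G\<^sub>2" using D F by blast
  have "card (points G\<^sub>1) = 2 * m" "card (points G\<^sub>2) = 2 * l"
    unfolding p1 p2 using m by auto
  then have ml: "m = l" using G by simp
  have set_eq: "insert 1 {i + 2..i + 2 * m} = insert 1 {j + 2..j + 2 * m}"
    using p1(3) p2(3) G ml by simp
  have "i + 2 \<in> insert 1 {i + 2..i + 2 * m}" "j + 2 \<in> insert 1 {j + 2..j + 2 * m}"
    using m by auto
  then have "i + 2 \<in> insert 1 {j + 2..j + 2 * m}" "j + 2 \<in> insert 1 {i + 2..i + 2 * m}"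
    by (simp_all only: set_eq)
  then have ij: "i = j" by auto
  have pts: "points C' = {1..2 * m}" "points B' = {1..2 * m}"
    using C' B' ml by (auto simp: chord_diagram_iff)
  have "C' = B'"
    using G unfolding G\<^sub>1_def G\<^sub>2_def ij
    by (rule map_prod_image_inj)
      (unfold pts Un_absorb, rule strict_mono_on_imp_inj_on[OF strict_mono_on_shift_nonroot])
  moreover have "C'' = B''"
    using F unfolding F\<^sub>1_def F\<^sub>2_def ij ml
    by (rule map_prod_image_inj)
      (rule strict_mono_on_imp_inj_on[OF strict_mono_on_open_gap[OF m(2)]])
  ultimately show ?thesis using ij by blast
qed

text \<open>For a point different from \<open>p\<close> and \<open>q\<close>, the equivalence
  \<open>x < p \<longleftrightarrow> x < q\<close> says that it is not between them. A chord with
  one end inside but not crossing \<open>(p, q)\<close> lies inside entirely, and then no chord with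
  both ends outside can cross it. So being outside spreads along crossings.\<close>

lemma noncrossing_same_side:
  fixes p q :: nat
  assumes ord: "p < q" "x < y" and ne: "x \<noteq> p" "x \<noteq> q" "y \<noteq> p" "y \<noteq> q"
    and nc: "\<not> (p < x \<and> x < q \<and> q < y)" "\<not> (x < p \<and> p < y \<and> y < q)"
    and out: "a < p \<longleftrightarrow> a < q" "b < p \<longleftrightarrow> b < q"
    and cross: "a < x \<and> x < b \<and> b < y \<or> x < a \<and> a < y \<and> y < b"
  shows "(x < p \<longleftrightarrow> x < q) \<and> (y < p \<longleftrightarrow> y < q)"
proof -
  have "\<not> (p < x \<and> x < q)"
  proof
    assume x: "p < x \<and> x < q"
    then have "y < q" using nc(1) ne(4) by linarith
    from cross show False
    proof
      assume "a < x \<and> x < b \<and> b < y"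
      then show False using x \<open>y < q\<close> out(2) by linarith
    next
      assume "x < a \<and> a < y \<and> y < b"
      then show False using x \<open>y < q\<close> out(1) by linarith
    qed
  qed
  moreover from this have "\<not> (p < y \<and> y < q)" using nc(2) ne ord by linarith
  ultimately show ?thesis using ord ne by linarith
qed

text \<open>The chords of \<open>L\<close> give \<open>C''\<close>, the remaining chords
  \<open>M\<close> give \<open>C'\<close>, and \<open>i\<close> is the number of endpoints of
  \<open>L\<close> before \<open>r\<close>.\<close>

lemma insert_diagram_surj:
  assumes D: "chord_diagram N D" "connected_diagram D" and N: "N \<ge> 2"
  obtains i m n C' C'' where "D = insert_diagram i C' C''" "m + n = N" "i \<in> {1..2 * n - 1}"
    "chord_diagram m C'" "connected_diagram C'" "chord_diagram n C''" "connected_diagram C''"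
proof -
  have mat: "matching D" and pts: "points D = {1..2 * N}" using D by (auto simp: chord_diagram_iff)
  have fin: "finite D" using D(1) by (rule chord_diagram_finite)
  obtain r where r: "(1, r) \<in> D" "\<And>c. c \<in> D \<Longrightarrow> c \<noteq> (1, r) \<Longrightarrow> 1 < fst c"
    using chord_diagram_root[OF D(1)] N by (metis One_nat_def Suc_1 Suc_leD)
  let ?r = "(1, r)"
  have r1: "1 < r" using matching_less[OF mat r(1)] by simp
  have "card D = N" using D(1) by (rule chord_diagram_card)
  have r2: "2 < r"
  proof (rule ccontr)
    assume "\<not> 2 < r"
    then have "r = 2" using r1 by simp
    \<comment> \<open>A chord from 1 to 2 crosses nothing, so it would be a component by
      itself.\<close>
    have "{?r} = D"
    proof (rule connected_diagram_closedD[OF D(2)])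
      fix c d assume c: "c \<in> {?r}" and d: "d \<in> D" "crosses c d"
      show "d \<in> {?r}"
        using r(2)[OF d(1)] c d(2) \<open>r = 2\<close> by (cases "d = ?r") (auto simp: crosses_iff)
    qed (use r in auto)
    then show False using \<open>card D = N\<close> N by (metis card_1_singleton_iff card.empty card_insert_disjoint
      finite.emptyI empty_iff One_nat_def not_less_eq_eq Suc_1 le_refl)
  qed
  have "2 \<in> points D" using pts N by auto
  then obtain c\<^sub>0 where c\<^sub>0: "c\<^sub>0 \<in> D" "2 = fst c\<^sub>0 \<or> 2 = snd c\<^sub>0" by (rule points_obtain)
  have c\<^sub>0r: "c\<^sub>0 \<noteq> ?r" using c\<^sub>0 r2 by auto
  have fst_c\<^sub>0: "fst c\<^sub>0 = 2" using r(2)[OF c\<^sub>0(1) c\<^sub>0r] matching_less[OF mat c\<^sub>0(1)] c\<^sub>0(2) by auto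
  obtain L where L: "L \<subseteq> D - {?r}" "c\<^sub>0 \<in> L" "connected_diagram L"
    and L_closed: "\<And>c d. c \<in> L \<Longrightarrow> d \<in> D - {?r} \<Longrightarrow> crosses c d \<Longrightarrow> d \<in> L"
  proof -
    have "c\<^sub>0 \<in> D - {?r}" using c\<^sub>0 c\<^sub>0r by blast
    then obtain L where L: "L \<subseteq> D - {?r}" "c\<^sub>0 \<in> L" "connected_graph L {(c, d). crosses c d}"
      and cl: "\<And>u v. u \<in> L \<Longrightarrow> v \<in> D - {?r} \<Longrightarrow>
        (u, v) \<in> {(c, d). crosses c d} \<or> (v, u) \<in> {(c, d). crosses c d} \<Longrightarrow> v \<in> L"
      by (rule connected_component_exists[where E = "{(c, d). crosses c d}"]) blast
    show thesis
    proof (rule that[OF L(1,2)])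
      show "connected_diagram L" unfolding connected_diagram_def by (rule L(3))
      fix c d assume "c \<in> L" "d \<in> D - {?r}" "crosses c d"
      then show "d \<in> L" using cl[of c d] by simp
    qed
  qed
  define K where "K = D - {?r} - L"
  define M where "M = D - L"
  have M: "M = insert ?r K" using r(1) L(1) unfolding M_def K_def by blast
  have KL: "\<not> crosses c d" if "c \<in> K" "d \<in> L" for c d
    using L_closed[of d c] crosses_sym[of c d] that unfolding K_def by blast
  have Lpts: "points L \<subseteq> {2..2 * N}"
  proof
    fix s assume "s \<in> points L"
    then obtain c where c: "c \<in> L" "s = fst c \<or> s = snd c" by (rule points_obtain)
    then have "1 < fst c" "c \<in> D" using r(2)[of c] L(1) by blast+
    moreover from this have "fst c < snd c" "snd c \<le> 2 * N"
      using matching_less[OF mat] in_points(2)[of c D] pts by auto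
    ultimately show "s \<in> {2..2 * N}" using c(2) by auto
  qed
  have Kpts: "s \<noteq> fst c" "s \<noteq> snd c" if "c \<in> M" "s \<in> points L" for c s
  proof -
    have "points M = points D - points L" unfolding M_def
      by (rule points_Diff[OF mat]) (use L in blast)
    then show "s \<noteq> fst c" "s \<noteq> snd c" using in_points[OF that(1)] that(2) by blast+
  qed
  \<comment> \<open>A chord outside \<open>L\<close> does not cross the connected set \<open>L\<close>, so \<open>L\<close> lies on one side of it; the
    endpoint 2 shows that this is the outer side.\<close>
  have outside: "s < fst c \<longleftrightarrow> s < snd c" if c: "c \<in> K" and s: "s \<in> points L" for c s
  proof -
    have cM: "c \<in> M" using c M by blast
    have cD: "c \<in> D" "c \<noteq> ?r" "c \<notin> L" using c unfolding K_def by auto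
    have "fst c \<noteq> 2"
      using Kpts(1)[OF cM in_points(1)[OF L(2)]] fst_c\<^sub>0 by simp
    then have c2: "2 < fst c" "fst c < snd c" using r(2)[OF cD(1,2)] matching_less[OF mat cD(1)] by auto
    define S where "S = {d \<in> L. (fst d < fst c \<longleftrightarrow> fst d < snd c) \<and> (snd d < fst c \<longleftrightarrow> snd d < snd c)}"
    have ne: "fst d \<noteq> fst c" "fst d \<noteq> snd c" "snd d \<noteq> fst c" "snd d \<noteq> snd c" "fst d < snd d" "\<not> crosses c d"
      if "d \<in> L" for d
      using Kpts[OF cM] in_points[OF that] KL[OF c that] matching_less[OF mat, of d] L(1) that by blast+
    have "S = L"
    proof (rule connected_diagram_closedD[OF L(3)])
      have "c\<^sub>0 \<in> S" using ne[OF L(2)] L(2) c2 fst_c\<^sub>0 unfolding S_def by (auto simp: crosses_iff)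
      then show "S \<noteq> {}" by blast
    next
      fix d e assume d: "d \<in> S" and e: "e \<in> L" and cross: "crosses d e"
      note e' = ne[OF e, unfolded crosses_iff de_Morgan_disj]
      have "(fst e < fst c \<longleftrightarrow> fst e < snd c) \<and> (snd e < fst c \<longleftrightarrow> snd e < snd c)"
        by (rule noncrossing_same_side[OF c2(2) e'(5,1-4) conjunct1[OF e'(6)] conjunct2[OF e'(6)],
            where a = "fst d" and b = "snd d"])
          (use d cross in \<open>auto simp: S_def crosses_iff\<close>)
      then show "e \<in> S" unfolding S_def using e by blast
    qed (auto simp: S_def)
    moreover obtain d where d: "d \<in> L" "s = fst d \<or> s = snd d" using s by (rule points_obtain)
    ultimately show ?thesis unfolding S_def by blast
  qed
  \<comment> \<open>The chords outside \<open>L\<close> in the same gap of \<open>L\<close> as \<open>r\<close>.\<close>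
  define X where "X = {c \<in> K. \<forall>s\<in>points L. s < fst c \<longleftrightarrow> s < r}"
  have "K - X = {}"
  proof (rule ccontr)
    assume ne: "K - X \<noteq> {}"
    \<comment> \<open>A chord crossing one of \<open>K - X\<close> is not in \<open>L\<close>. It is
      neither the root chord nor in \<open>X\<close>, for two chords that do not separate endpoints
      of \<open>L\<close> and cross lie in the same gap; the root chord can take part through its
      end \<open>r\<close>. So \<open>K - X\<close> is closed, but it misses the root chord.\<close>
    have "K - X = D"
    proof (rule connected_diagram_closedD[OF D(2) _ ne])
      fix c d assume c: "c \<in> K - X" and d: "d \<in> D" and cross: "crosses c d"
      have "d \<notin> L" using KL c cross by blast
      moreover have "d \<noteq> ?r"
      proof
        assume "d = ?r"
        then have "fst c < r" "r < snd c" using cross r(2)[of c] c unfolding K_def by (auto simp: crosses_iff)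
        then have "s < fst c \<longleftrightarrow> s < r" if "s \<in> points L" for s
          using outside[of c s] that c by auto
        then show False using c unfolding X_def by blast
      qed
      moreover have "d \<notin> X"
      proof
        assume d: "d \<in> X"
        have "s < fst c \<longleftrightarrow> s < r" if "s \<in> points L" for s
        proof -
          have "s < fst c \<longleftrightarrow> s < snd c" "s < fst d \<longleftrightarrow> s < snd d" "s < fst d \<longleftrightarrow> s < r"
            using outside[of c s] outside[of d s] that c d unfolding X_def by auto
          then show ?thesis using cross unfolding crosses_iff by linarith
        qed
        then show False using c unfolding X_def by blast
      qed
      ultimately show "d \<in> K - X" using d unfolding K_def by blast
    qed (auto simp: K_def)
    then show False using r(1) unfolding K_def by blast
  qed
  then have side: "s < fst c \<longleftrightarrow> s < r" "s < snd c \<longleftrightarrow> s < r" if "c \<in> K" "s \<in> points L" for c s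
    using outside[OF that] that unfolding X_def by blast+
  have matM: "matching M" "matching L" using matching_subset[OF mat] L(1) unfolding M_def by blast+
  have finM: "finite M" "finite L" using fin finite_subset[of L D] L(1) unfolding M_def by auto
  have DML: "D = M \<union> L" "M \<inter> L = {}" using L(1) unfolding M_def by auto
  define m n where "m = card M" and "n = card L"
  have mn: "m + n = N" using DML finM \<open>card D = N\<close> unfolding m_def n_def by (metis card_Un_disjoint)
  have m1: "m \<ge> 1" using finM(1) M unfolding m_def by (auto simp: Suc_le_eq card_gt_0_iff)
  have ptsM: "points M = {1..2 * N} - points L"
    unfolding M_def pts[symmetric] by (rule points_Diff[OF mat]) (use L in blast)
  have cardM: "card (points M) = 2 * m" "card (points L) = 2 * n"
    using card_points[OF matM(1) finM(1)] card_points[OF matM(2) finM(2)] unfolding m_def n_def by auto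
  have sideM: "s < p \<longleftrightarrow> s < r" if pM: "p \<in> points M" and "p \<noteq> 1" "s \<in> points L" for p s
  proof -
    obtain c where c: "c \<in> M" "p = fst c \<or> p = snd c" using pM by (rule points_obtain)
    show ?thesis
    proof (cases "c = ?r")
      case True
      then show ?thesis using c that(2) by auto
    next
      case False
      then have "c \<in> K" using c M by blast
      then show ?thesis using side[of c s] c(2) that(3) by auto
    qed
  qed
  have rL: "r \<notin> points L" using Kpts(2)[of ?r r] M by auto
  define A where "A = {s \<in> points L. s < r}"
  define i where "i = card A"
  have finL: "finite (points L)" using Lpts finite_subset by blast
  \<comment> \<open>A point of \<open>M\<close> other than 1 below some \<open>x\<close> in
    \<open>A\<close> would have \<open>x\<close> on its right, while \<open>x\<close> is left of
    \<open>r\<close>; \<open>sideM\<close> forbids this.\<close>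
  have "A = {2..<2 + card A}"
  proof (rule downset_interval)
    show "finite A" unfolding A_def using finL by simp
    show "2 \<le> x" if "x \<in> A" for x using that Lpts unfolding A_def by auto
    show "y \<in> A" if "x \<in> A" "2 \<le> y" "y < x" for x y
    proof -
      have x: "x \<in> points L" "x < r" using that(1) unfolding A_def by auto
      have "y \<in> {1..2 * N}" using x that(2,3) Lpts by auto
      then have "y \<in> points L" using ptsM sideM[of y x] x that(2,3) by auto
      then show ?thesis using that x unfolding A_def by auto
    qed
  qed
  also have "\<dots> = {2..i + 1}" unfolding i_def[symmetric] by auto
  finally have A: "A = {2..i + 1}" .
  define T where "T = points M - {1}"
  have "1 \<in> points M" using in_points(1)[of ?r M] M by auto
  then have cardT: "card T = 2 * m - 1" unfolding T_def using cardM(1) by simp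
  \<comment> \<open>An endpoint of \<open>L\<close> below some point of \<open>T\<close> lies before
    \<open>r\<close> by \<open>sideM\<close>, hence is at most \<open>i + 1\<close>. So
    \<open>T\<close> has no holes.\<close>
  have "T = {i + 2..<i + 2 + card T}"
  proof (rule downset_interval)
    show "finite T" unfolding T_def ptsM by simp
    show "i + 2 \<le> x" if "x \<in> T" for x
    proof -
      have "x \<notin> A" using that unfolding T_def ptsM A_def by auto
      moreover have "x \<ge> 2" using that unfolding T_def ptsM by auto
      ultimately show ?thesis unfolding A by auto
    qed
    show "y \<in> T" if "x \<in> T" "i + 2 \<le> y" "y < x" for x y
    proof (rule ccontr)
      assume "y \<notin> T"
      moreover have "y \<in> {2..2 * N}" using that unfolding T_def ptsM by auto
      ultimately have y: "y \<in> points L" unfolding T_def ptsM by auto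
      moreover have "y \<notin> A" unfolding A using that by auto
      ultimately show False using sideM[of x y] that unfolding T_def A_def by auto
    qed
  qed
  also have "\<dots> = {i + 2..i + 2 * m}" unfolding cardT using m1 by auto
  finally have T: "T = {i + 2..i + 2 * m}" .
  have ptsM': "points M = insert 1 {i + 2..i + 2 * m}"
    using T \<open>1 \<in> points M\<close> unfolding T_def by blast
  have ptsL: "points L = {2..i + 1} \<union> {i + 2 * m + 1..2 * n + 2 * m}"
  proof -
    have "i + 2 * m \<in> T" unfolding T using m1 by auto
    then have le: "i + 2 * m \<le> 2 * N" unfolding T_def ptsM by auto
    have "points L = {1..2 * N} - points M" using ptsM Lpts by auto
    also have "\<dots> = {1..2 * N} - insert 1 {i + 2..i + 2 * m}" unfolding ptsM' ..
    also have "\<dots> = {2..i + 1} \<union> {i + 2 * m + 1..2 * N}" using le m1 by auto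
    also have "2 * N = 2 * n + 2 * m" using mn by simp
    finally show ?thesis .
  qed
  have "2 \<in> A" using in_points(1)[OF L(2)] fst_c\<^sub>0 r2 unfolding A_def by simp
  then have i1: "i \<ge> 1" unfolding A by simp
  \<comment> \<open>Otherwise \<open>L\<close> would be closed in \<open>D\<close>. Such a chord
    ends after \<open>r\<close>, so \<open>L\<close> has endpoints on both sides of the gap and
    \<open>i < 2 * n\<close>.\<close>
  have "\<exists>d\<in>L. crosses d ?r"
  proof (rule ccontr)
    assume none: "\<not> ?thesis"
    have "L = D"
    proof (rule connected_diagram_closedD[OF D(2)])
      fix c d assume "c \<in> L" "d \<in> D" "crosses c d"
      then show "d \<in> L" using L_closed[of c d] none by blast
    qed (use L in auto)
    then show False using L(1) r(1) by blast
  qed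
  then obtain d where d: "d \<in> L" "crosses d ?r" by blast
  have "1 < fst d" using r(2)[of d] d(1) L(1) by blast
  then have "snd d > r" using d(2) by (auto simp: crosses_iff)
  then have "snd d \<in> points L" "snd d \<notin> A" using in_points(2)[OF d(1)] unfolding A_def by auto
  then have "A \<subset> points L" unfolding A_def by auto
  then have i2: "i < 2 * n" using psubset_card_mono[OF finL] cardM(2) unfolding i_def by simp
  \<comment> \<open>Inverses of \<open>open_gap i m\<close> on the points of \<open>L\<close> and of
    \<open>shift_nonroot i\<close> on the points of \<open>M\<close>.\<close>
  define f g where "f s = (if s \<le> i + 1 then s - 1 else s - 2 * m)"
    and "g p = (if p = 1 then 1 else p - i)" for s p :: nat
  have monoL: "strict_mono_on (points L) f"
    unfolding ptsL strict_mono_on_def f_def by auto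
  have monoM: "strict_mono_on (points M) g"
    unfolding ptsM' strict_mono_on_def g_def by auto
  have inv_f: "open_gap i m (f s) = s" if "s \<in> points L" for s
    using that m1 unfolding ptsL f_def open_gap_def by auto
  have inv_g: "shift_nonroot i (g p) = p" if "p \<in> points M" for p
    using that unfolding ptsM' g_def shift_nonroot_def by auto
  have "f ` points L = {1..2 * n}"
  proof
    show "f ` points L \<subseteq> {1..2 * n}" unfolding ptsL f_def using i2 m1 by auto
    show "{1..2 * n} \<subseteq> f ` points L"
    proof
      fix p assume p: "p \<in> {1..2 * n}"
      have "open_gap i m p \<in> points L"
        using p i2 open_gap_image[of i "2 * n" m] unfolding ptsL by (metis imageI less_imp_le)
      moreover have "f (open_gap i m p) = p" using p m1 by (auto simp: f_def open_gap_def)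
      ultimately show "p \<in> f ` points L" by (metis imageI)
    qed
  qed
  moreover have "g ` points M = {1..2 * m}"
  proof
    show "g ` points M \<subseteq> {1..2 * m}" unfolding ptsM' g_def using m1 by auto
    show "{1..2 * m} \<subseteq> g ` points M"
    proof
      fix p assume p: "p \<in> {1..2 * m}"
      have "shift_nonroot i p \<in> points M"
        using p shift_nonroot_image[OF m1, of i] unfolding ptsM' by (metis imageI)
      moreover have "g (shift_nonroot i p) = p" using p by (auto simp: g_def shift_nonroot_def)
      ultimately show "p \<in> g ` points M" by (metis imageI)
    qed
  qed
  ultimately have diag: "chord_diagram m (map_prod g g ` M)" "chord_diagram n (map_prod f f ` L)"
    unfolding chord_diagram_iff points_image
    using matching_image[OF matM(1) monoM] matching_image[OF matM(2) monoL] by auto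
  have "connected_diagram M"
  proof (rule connected_diagramI_closed)
    fix S assume S: "S \<subseteq> M" "S \<noteq> {}"
      and cl: "\<And>c d. c \<in> S \<Longrightarrow> d \<in> M \<Longrightarrow> crosses c d \<Longrightarrow> d \<in> S"
    \<comment> \<open>Chords of \<open>K\<close> do not cross \<open>L\<close>, so a closed subset
      of \<open>M\<close> without the root chord would be closed in \<open>D\<close>. Once the root
      chord is in \<open>S\<close>, the union of \<open>S\<close> and \<open>L\<close> is closed in
      \<open>D\<close>.\<close>
    have "?r \<in> S"
    proof (rule ccontr)
      assume rS: "?r \<notin> S"
      have "S = D"
      proof (rule connected_diagram_closedD[OF D(2) _ S(2)])
        fix c d assume c: "c \<in> S" "d \<in> D" "crosses c d"
        then have "d \<notin> L" using KL[of c d] rS S(1) M by blast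
        then show "d \<in> S" using cl[of c d] c DML by blast
      qed (use S M_def in blast)
      then show False using r(1) rS by blast
    qed
    have "S \<union> L = D"
    proof (rule connected_diagram_closedD[OF D(2)])
      fix c d assume c: "c \<in> S \<union> L" "d \<in> D" "crosses c d"
      show "d \<in> S \<union> L"
      proof (cases "c \<in> S")
        case True
        then show ?thesis using cl[of c d] c DML by blast
      next
        case False
        then show ?thesis using c L_closed[of c d] \<open>?r \<in> S\<close> by blast
      qed
    qed (use S DML in auto)
    then show "M \<subseteq> S" using DML by blast
  qed (use M in blast)
  then have conn: "connected_diagram (map_prod g g ` M)" "connected_diagram (map_prod f f ` L)"
    using connected_diagram_image monoM monoL L(3) by blast+
  have "map_prod (shift_nonroot i) (shift_nonroot i) ` map_prod g g ` M = M"
    unfolding image_image using inv_g in_points[of _ M] by (force simp: map_prod_def case_prod_unfold image_iff)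
  moreover have "map_prod (open_gap i m) (open_gap i m) ` map_prod f f ` L = L"
    unfolding image_image using inv_f in_points[of _ L] by (force simp: map_prod_def case_prod_unfold image_iff)
  ultimately have "insert_diagram i (map_prod g g ` M) (map_prod f f ` L) = D"
    using insert_diagram_eq[OF diag(1) m1] DML(1) by simp
  then show thesis using that[OF _ mn _ diag(1) conn(1) diag(2) conn(2), of i] i1 i2 by auto
qed

section \<open>Binary tubings and their diagrams\<close>

text \<open>The graph of \<open>\<theta>\<close>, with the choice of names left open.\<close>

inductive tubing_diagram :: "'v vtree \<Rightarrow> 'v set set \<Rightarrow> (nat \<times> nat) set \<Rightarrow> bool" where
  tubing_diagram_leaf: "tubing_diagram (Node v []) {{v}} {(1, 2)}"
| tubing_diagram_graft:
    "tubing_diagram t' \<tau>' C' \<Longrightarrow> tubing_diagram t'' \<tau>'' C'' \<Longrightarrow> verts t' \<inter> verts t'' = {} \<Longrightarrow>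
     i \<in> {1..length (rtips t'')} \<Longrightarrow> grafts t' (rtips t'' ! (i - 1)) t'' t \<Longrightarrow>
     tubing_diagram t (insert (verts t) (\<tau>' \<union> \<tau>'')) (insert_diagram i C' C'')"

lemma tubing_diagram_distinct: "tubing_diagram t \<tau> C \<Longrightarrow> distinct (preorder t)"
  by (induction rule: tubing_diagram.induct) (auto simp: distinct_grafts_iff)

lemma tubing_diagram_verts_in: "tubing_diagram t \<tau> C \<Longrightarrow> verts t \<in> \<tau>"
  by (cases rule: tubing_diagram.cases) auto

lemma tubing_diagram_tubes:
  "tubing_diagram t \<tau> C \<Longrightarrow> S \<in> \<tau> \<Longrightarrow> S \<subseteq> verts t \<and> S \<noteq> {}"
  by (induction rule: tubing_diagram.induct) (auto simp: verts_grafts)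

lemma tubing_diagram_diagram:
  "tubing_diagram t \<tau> C \<Longrightarrow> chord_diagram (length (preorder t)) C \<and> connected_diagram C"
proof (induction rule: tubing_diagram.induct)
  case (tubing_diagram_leaf v)
  then show ?case using chord_diagram_single connected_diagram_single by simp
next
  case (tubing_diagram_graft t' \<tau>' C' t'' \<tau>'' C'' i t)
  then show ?case
    using insert_diagram_chord_diagram[of "length (preorder t')" C' "length (preorder t'')" C'' i]
      length_preorder_grafts[of t' _ t'' t] length_rtips(1)[of t''] by auto
qed

text \<open>The one edge added by the graft has an end in each tree, so it never lies inside a set
  of vertices of just one of them.\<close>

lemma connected_graph_grafts_iff:
  assumes "grafts t' x t'' t" "verts t' \<inter> verts t'' = {}"
  shows "S \<subseteq> verts t' \<Longrightarrow> connected_graph S (edges t) \<longleftrightarrow> connected_graph S (edges t')"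
    and "S \<subseteq> verts t'' \<Longrightarrow> connected_graph S (edges t) \<longleftrightarrow> connected_graph S (edges t'')"
proof -
  have x: "fst x \<in> verts t''" using grafts_in_rtips[OF assms(1)] rtips_verts(1) by blast
  have e: "(u, v) \<in> edges t \<longleftrightarrow> (u = fst x \<and> v = root t') \<or> (u, v) \<in> edges t' \<or> (u, v) \<in> edges t''" for u v
    using edges_grafts[OF assms(1)] by auto
  show "connected_graph S (edges t) \<longleftrightarrow> connected_graph S (edges t')" if "S \<subseteq> verts t'"
  proof (rule connected_graph_cong)
    fix u v assume "u \<in> S" "v \<in> S"
    then have "u \<notin> verts t''" using that assms(2) by blast
    then show "(u, v) \<in> edges t \<longleftrightarrow> (u, v) \<in> edges t'"
      using e[of u v] x edges_subset_verts[of u v t''] by metis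
  qed
  show "connected_graph S (edges t) \<longleftrightarrow> connected_graph S (edges t'')" if "S \<subseteq> verts t''"
  proof (rule connected_graph_cong)
    fix u v assume "u \<in> S" "v \<in> S"
    then have "v \<notin> verts t'" using that assms(2) by blast
    then show "(u, v) \<in> edges t \<longleftrightarrow> (u, v) \<in> edges t''"
      using e[of u v] edges_subset_verts[of u v t'] root_in_verts[of t'] by metis
  qed
qed

section \<open>From \<open>tubing_diagram\<close> to binary tubings\<close>

lemma binary_tubing_tubeD:
  "binary_tubing t \<tau> \<Longrightarrow> S \<in> \<tau> \<Longrightarrow> S \<subseteq> verts t \<and> connected_graph S (edges t)"
  by (simp add: binary_tubing_def tube_def)

lemma binary_tubing_nestedD:
  "binary_tubing t \<tau> \<Longrightarrow> A \<in> \<tau> \<Longrightarrow> B \<in> \<tau> \<Longrightarrow> A \<subseteq> B \<or> B \<subseteq> A \<or> A \<inter> B = {}"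
  by (simp add: binary_tubing_def)

lemma binary_tubing_splitD:
  "binary_tubing t \<tau> \<Longrightarrow> S \<in> \<tau> \<Longrightarrow>
    (\<exists>v. S = {v}) \<or> (\<exists>A\<in>\<tau>. \<exists>B\<in>\<tau>. A \<noteq> S \<and> B \<noteq> S \<and> partition_on S {A, B})"
  by (simp add: binary_tubing_def)

lemma tubing_diagram_binary_tubing: "tubing_diagram t \<tau> C \<Longrightarrow> binary_tubing t \<tau>"
proof (induction rule: tubing_diagram.induct)
  case (tubing_diagram_leaf v)
  show ?case by (auto simp: binary_tubing_def tube_def connected_graph_def)
next
  case (tubing_diagram_graft t' \<tau>' C' t'' \<tau>'' C'' i t)
  note g = tubing_diagram_graft.hyps(5) and disj = tubing_diagram_graft.hyps(3)
  let ?x = "rtips t'' ! (i - 1)" and ?\<tau> = "insert (verts t) (\<tau>' \<union> \<tau>'')"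
  note conn = connected_graph_grafts_iff[OF g disj]
  have V: "verts t = verts t' \<union> verts t''" using g by (rule verts_grafts)
  note in1 = tubing_diagram_verts_in[OF tubing_diagram_graft.hyps(1)]
  note in2 = tubing_diagram_verts_in[OF tubing_diagram_graft.hyps(2)]
  have sub1: "S \<subseteq> verts t'" if "S \<in> \<tau>'" for S
    using tubing_diagram_tubes[OF tubing_diagram_graft.hyps(1) that] by blast
  have sub2: "S \<subseteq> verts t''" if "S \<in> \<tau>''" for S
    using tubing_diagram_tubes[OF tubing_diagram_graft.hyps(2) that] by blast
  have tube1: "tube t S" if "S \<in> \<tau>'" for S
    using binary_tubing_tubeD[OF tubing_diagram_graft.IH(1) that] conn(1)[OF sub1[OF that]] V
    unfolding tube_def by blast
  have tube2: "tube t S" if "S \<in> \<tau>''" for S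
    using binary_tubing_tubeD[OF tubing_diagram_graft.IH(2) that] conn(2)[OF sub2[OF that]] V
    unfolding tube_def by blast
  have "connected_graph (verts t' \<union> verts t'') (edges t)"
  proof (rule connected_graph_Un)
    show "connected_graph (verts t') (edges t)" "connected_graph (verts t'') (edges t)"
      using tube1[OF in1] tube2[OF in2] unfolding tube_def by auto
    show "root t' \<in> verts t'" "fst ?x \<in> verts t''"
      using rtips_verts(1)[OF grafts_in_rtips[OF g]] by simp_all
    show "(root t', fst ?x) \<in> edges t \<or> (fst ?x, root t') \<in> edges t"
      using edges_grafts[OF g] by simp
  qed
  then have "tube t (verts t)" unfolding tube_def V[symmetric] by simp
  then have tubes: "\<forall>S\<in>?\<tau>. tube t S" using tube1 tube2 by blast
  have lam: "A \<subseteq> B \<or> B \<subseteq> A \<or> A \<inter> B = {}" if AB: "A \<in> ?\<tau>" "B \<in> ?\<tau>" for A B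
  proof -
    have lam1: "A \<subseteq> B \<or> B \<subseteq> A \<or> A \<inter> B = {}" if "A \<in> \<tau>'" "B \<in> \<tau>'"
      using that by (rule binary_tubing_nestedD[OF tubing_diagram_graft.IH(1)])
    have lam2: "A \<subseteq> B \<or> B \<subseteq> A \<or> A \<inter> B = {}" if "A \<in> \<tau>''" "B \<in> \<tau>''"
      using that by (rule binary_tubing_nestedD[OF tubing_diagram_graft.IH(2)])
    consider "A = verts t" | "B = verts t" | "A \<in> \<tau>'" "B \<in> \<tau>'" | "A \<in> \<tau>''" "B \<in> \<tau>''"
      | "A \<in> \<tau>'" "B \<in> \<tau>''" | "A \<in> \<tau>''" "B \<in> \<tau>'" using AB by blast
    then show ?thesis
    proof cases
      case 1
      then show ?thesis using AB(2) V sub1[of B] sub2[of B] by blast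
    next
      case 2
      then show ?thesis using AB(1) V sub1[of A] sub2[of A] by blast
    next
      case 5
      then show ?thesis using sub1[of A] sub2[of B] disj by blast
    next
      case 6
      then show ?thesis using sub2[of A] sub1[of B] disj by blast
    qed (use lam1 lam2 in blast)+
  qed
  have split: "(\<exists>v. S = {v}) \<or>
      (\<exists>A\<in>?\<tau>. \<exists>B\<in>?\<tau>. A \<noteq> S \<and> B \<noteq> S \<and> partition_on S {A, B})" if S: "S \<in> ?\<tau>" for S
  proof -
    consider "S = verts t" | "S \<in> \<tau>'" | "S \<in> \<tau>''" using S by blast
    then show ?thesis
    proof cases
      case 1
      have "verts t' \<noteq> verts t" "verts t'' \<noteq> verts t"
        using V disj verts_nonempty[of t'] verts_nonempty[of t''] by blast+
      moreover have "partition_on (verts t) {verts t', verts t''}"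
        using V disj verts_nonempty[symmetric] by (auto simp: partition_on_def disjoint_def)
      ultimately show ?thesis using 1 in1 in2 by blast
    next
      case 2
      then have "(\<exists>v. S = {v}) \<or> (\<exists>A\<in>\<tau>'. \<exists>B\<in>\<tau>'. A \<noteq> S \<and> B \<noteq> S \<and> partition_on S {A, B})"
        by (rule binary_tubing_splitD[OF tubing_diagram_graft.IH(1)])
      then show ?thesis by blast
    next
      case 3
      then have "(\<exists>v. S = {v}) \<or> (\<exists>A\<in>\<tau>''. \<exists>B\<in>\<tau>''. A \<noteq> S \<and> B \<noteq> S \<and> partition_on S {A, B})"
        by (rule binary_tubing_splitD[OF tubing_diagram_graft.IH(2)])
      then show ?thesis by blast
    qed
  qed
  show ?case unfolding binary_tubing_def using tubes lam split by simp
qed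

text \<open>In a \<open>tubing_split\<close> only the composed tree is known to have distinct names,
  and \<open>grafts_attach\<close> asks for this in the tree attached to. Deriving it from
  \<open>grafts\<close> would be circular, hence a direct induction for arbitrary places.\<close>

lemma mset_preorder_attach: "mset (preorder t) \<subseteq># mset (preorder (attach t' x t))"
proof (induction t' x t rule: attach.induct)
  case (1 t' w j v ts)
  show ?case
  proof (cases "v = w")
    case True
    have "mset (concat (map preorder ts)) =
        mset (concat (map preorder (take j ts))) + mset (concat (map preorder (drop j ts)))"
      by (metis append_take_drop_id concat_append map_append mset_append)
    then show ?thesis using True by (simp add: subset_mset.add_left_mono)
  next
    case False
    have "mset (concat (map preorder us)) \<subseteq># mset (concat (map (\<lambda>s. preorder (attach t' (w, j) s)) us))"
      if "set us \<subseteq> set ts" for us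
      using that 1[OF False] by (induction us) (auto intro: subset_mset.add_mono)
    from this[of ts] show ?thesis using False by (simp add: o_def)
  qed
qed

lemma distinct_of_attach:
  assumes "distinct (preorder (attach t' x t))"
  shows "distinct (preorder t)"
proof -
  obtain M where "mset (preorder (attach t' x t)) = mset (preorder t) + M"
    using mset_preorder_attach by (metis mset_subset_eq_exists_conv)
  moreover obtain zs where "M = mset zs" by (metis ex_mset)
  ultimately have "mset (preorder (attach t' x t)) = mset (preorder t @ zs)" by simp
  then have "distinct (preorder t @ zs)" using assms mset_eq_imp_distinct_iff by blast
  then show ?thesis by simp
qed

text \<open>Removes the ambiguity of \<open>SOME\<close> in \<open>theta_named\<close>. Both parts
  of another split are proper tubes; the one with the root must lie in \<open>t''\<close>, and the
  other in \<open>t'\<close>, since \<open>t'\<close> must be covered. Covering forces equal vertex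
  sets, and \<open>grafts_inj\<close> does the rest.\<close>

lemma tubing_split_unique:
  assumes td: "tubing_diagram t' \<tau>' C'" "tubing_diagram t'' \<tau>'' C''"
    and disj: "verts t' \<inter> verts t'' = {}" and i: "i \<in> {1..length (rtips t'')}"
    and g: "grafts t' (rtips t'' ! (i - 1)) t'' t"
    and split: "tubing_split t (insert (verts t) (\<tau>' \<union> \<tau>'')) s' s'' j"
  shows "s' = t' \<and> s'' = t'' \<and> j = i"
proof -
  let ?\<tau> = "insert (verts t) (\<tau>' \<union> \<tau>'')"
  have dist'': "distinct (preorder t'')" and dist: "distinct (preorder t)"
    using tubing_diagram_distinct td disj by (auto simp: distinct_grafts_iff[OF g])
  have V: "verts t = verts t' \<union> verts t''" using g by (rule verts_grafts)
  let ?y = "rtips s'' ! (j - 1)"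
  have j: "j \<in> {1..length (rtips s'')}" and att: "t = attach s' ?y s''"
    and in': "verts s' \<in> ?\<tau>" and in'': "verts s'' \<in> ?\<tau>"
    using split unfolding tubing_split_def by auto
  have y: "?y \<in> set (rtips s'')" using j by (intro nth_mem) auto
  have g': "grafts s' ?y s'' t"
    using grafts_attach[OF y, of s'] distinct_of_attach[of s' ?y s''] dist att by simp
  have W: "verts t = verts s' \<union> verts s''" using g' by (rule verts_grafts)
  have disj': "verts s' \<inter> verts s'' = {}" using dist by (simp add: distinct_grafts_iff[OF g'])
  have sub1: "S \<subseteq> verts t'" if "S \<in> \<tau>'" for S using tubing_diagram_tubes[OF td(1) that] by blast
  have sub2: "S \<subseteq> verts t''" if "S \<in> \<tau>''" for S using tubing_diagram_tubes[OF td(2) that] by blast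
  have neq: "verts s' \<noteq> verts t" "verts s'' \<noteq> verts t"
    using W disj' verts_nonempty[of s'] verts_nonempty[of s''] by blast+
  have "root t \<in> verts s''" "root t \<in> verts t''"
    using root_grafts[OF g] root_grafts[OF g'] root_in_verts by metis+
  then have "verts s'' \<subseteq> verts t''" using in'' neq sub1[of "verts s''"] sub2[of "verts s''"] disj by blast
  moreover have "verts s' \<subseteq> verts t'"
  proof (rule ccontr)
    assume "\<not> verts s' \<subseteq> verts t'"
    then have "verts s' \<subseteq> verts t''" using in' neq sub1[of "verts s'"] sub2[of "verts s'"] by blast
    then show False using \<open>verts s'' \<subseteq> verts t''\<close> V W disj verts_nonempty[of t'] by blast
  qed
  ultimately have "verts s' = verts t'" using V W disj by blast
  then have eq: "t' = s'" "rtips t'' ! (i - 1) = ?y" "t'' = s''"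
    using grafts_inj[OF g g' dist] by auto
  moreover have "i - 1 = j - 1"
    using nth_eq_iff_index_eq[OF distinct_rtips(1)[OF dist''], of "i - 1" "j - 1"] eq i j by auto
  ultimately show ?thesis using i j by auto
qed

lemma tubing_diagram_theta: "tubing_diagram t \<tau> C \<Longrightarrow> theta_named t \<tau> = C"
proof (induction rule: tubing_diagram.induct)
  case (tubing_diagram_leaf v)
  then show ?case by (subst theta_named.simps) simp
next
  case (tubing_diagram_graft t' \<tau>' C' t'' \<tau>'' C'' i t)
  note h = tubing_diagram_graft.hyps
  let ?\<tau> = "insert (verts t) (\<tau>' \<union> \<tau>'')"
  have V: "verts t = verts t' \<union> verts t''" using h(5) by (rule verts_grafts)
  have "t = attach t' (rtips t'' ! (i - 1)) t''"
    using attach_eq_of_grafts[OF h(5)] tubing_diagram_distinct[OF h(2)] by blast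
  then have split: "tubing_split t ?\<tau> t' t'' i"
    unfolding tubing_split_def using h(4) tubing_diagram_verts_in h(1,2) by blast
  have "(SOME (s', s'', j). tubing_split t ?\<tau> s' s'' j) = (t', t'', i)"
  proof (rule some_equality)
    show "case (t', t'', i) of (s', s'', j) \<Rightarrow> tubing_split t ?\<tau> s' s'' j" using split by simp
    fix z assume "case z of (s', s'', j) \<Rightarrow> tubing_split t ?\<tau> s' s'' j"
    then show "z = (t', t'', i)" using tubing_split_unique[OF h] by (cases z) auto
  qed
  \<comment> \<open>Tubes are nonempty, so none from \<open>t''\<close> fits into \<open>t'\<close>,
    and the full vertex set is too large.\<close>
  moreover have "tubing_restrict ?\<tau> t' = \<tau>'"
    using tubing_diagram_tubes[OF h(1)] tubing_diagram_tubes[OF h(2)] V h(3) verts_nonempty[of t'']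
    unfolding tubing_restrict_def by blast
  moreover have "tubing_restrict ?\<tau> t'' = \<tau>''"
    using tubing_diagram_tubes[OF h(1)] tubing_diagram_tubes[OF h(2)] V h(3) verts_nonempty[of t']
    unfolding tubing_restrict_def by blast
  ultimately show ?case
    using tubing_diagram_graft.IH children_grafts[OF h(5)] split
    by (subst theta_named.simps) auto
qed

text \<open>The two parts of a tube contained in \<open>verts s\<close> are contained in it as well,
  so they survive the restriction.\<close>

lemma binary_tubing_restrict:
  assumes bt: "binary_tubing t \<tau>" and s: "verts s \<in> \<tau>"
    and conn: "\<And>S. S \<subseteq> verts s \<Longrightarrow> connected_graph S (edges t) \<longleftrightarrow> connected_graph S (edges s)"
  shows "binary_tubing s (tubing_restrict \<tau> s)"
proof -
  have "\<exists>A\<in>tubing_restrict \<tau> s. \<exists>B\<in>tubing_restrict \<tau> s. A \<noteq> S \<and> B \<noteq> S \<and> partition_on S {A, B}"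
    if S: "S \<in> tubing_restrict \<tau> s" "\<nexists>v. S = {v}" for S
  proof -
    obtain A B where AB: "A \<in> \<tau>" "B \<in> \<tau>" "A \<noteq> S" "B \<noteq> S" "partition_on S {A, B}"
      using binary_tubing_splitD[OF bt, of S] S unfolding tubing_restrict_def by blast
    then have "A \<subseteq> S" "B \<subseteq> S" by (auto simp: partition_on_def)
    then show ?thesis using AB S unfolding tubing_restrict_def by blast
  qed
  moreover have "tube s S" if "S \<in> tubing_restrict \<tau> s" for S
    using binary_tubing_tubeD[OF bt, of S] that conn[of S]
    unfolding tube_def tubing_restrict_def by blast
  moreover have "A \<subseteq> B \<or> B \<subseteq> A \<or> A \<inter> B = {}"
    if "A \<in> tubing_restrict \<tau> s" "B \<in> tubing_restrict \<tau> s" for A B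
    using binary_tubing_nestedD[OF bt, of A B] that unfolding tubing_restrict_def by blast
  moreover have "verts s \<in> tubing_restrict \<tau> s" using s unfolding tubing_restrict_def by blast
  ultimately show ?thesis unfolding binary_tubing_def by blast
qed

lemma binary_tubing_has_diagram:
  "binary_tubing t \<tau> \<Longrightarrow> distinct (preorder t) \<Longrightarrow> \<exists>C. tubing_diagram t \<tau> C"
proof (induction "length (preorder t)" arbitrary: t \<tau> rule: less_induct)
  case less
  note bt = less.prems(1) and dist = less.prems(2)
  have in\<tau>: "verts t \<in> \<tau>" using bt by (simp add: binary_tubing_def)
  note tubes = binary_tubing_tubeD[OF bt] and lam = binary_tubing_nestedD[OF bt]
  have ne: "S \<noteq> {}" if "S \<in> \<tau>" for S using tubes[OF that] by (simp add: connected_graph_def)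
  show ?case
  proof (cases "\<exists>v. verts t = {v}")
    case True
    then obtain v where v: "verts t = {v}" by blast
    obtain u ts where t: "t = Node u ts" by (cases t)
    have "length (preorder t) = 1" using card_verts[OF dist] v by simp
    moreover have "preorder s \<noteq> []" for s :: "'a vtree" by (cases s) simp
    ultimately have "ts = []" using t by (cases ts) auto
    then have "t = Node v []" using t v by auto
    moreover have "S = {v}" if "S \<in> \<tau>" for S
      using tubes[OF that] ne[OF that] unfolding v by blast
    then have "\<tau> = {{v}}" using in\<tau> unfolding v by blast
    ultimately show ?thesis using tubing_diagram_leaf[of v] by auto
  next
    case False
    then obtain A B where AB: "A \<in> \<tau>" "B \<in> \<tau>" "A \<noteq> verts t" "B \<noteq> verts t"
        "partition_on (verts t) {A, B}"
      using binary_tubing_splitD[OF bt in\<tau>] by blast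
    have un: "A \<union> B = verts t" using AB(5) by (auto simp: partition_on_def)
    then have "A \<noteq> B" using AB(3) by blast
    then have "A \<inter> B = {}" using AB(5) by (auto simp: partition_on_def disjoint_def)
    \<comment> \<open>The two parts are unordered; after a possible exchange the root is in
      \<open>B\<close>, and \<open>A\<close> becomes the grafted subtree.\<close>
    then have "\<exists>A B. A \<in> \<tau> \<and> B \<in> \<tau> \<and> A \<union> B = verts t \<and> A \<inter> B = {} \<and> root t \<in> B"
      using AB(1,2) un root_in_verts[of t] by blast
    then obtain A B where AB: "A \<in> \<tau>" "B \<in> \<tau>" "A \<union> B = verts t" "A \<inter> B = {}" "root t \<in> B"
      by blast
    then obtain t' x t'' where g: "grafts t' x t'' t" and A: "verts t' = A" and B: "verts t'' = B"
      using grafts_of_connected_partition[OF dist AB(3-5)] tubes[OF AB(1)] tubes[OF AB(2)] by blast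
    have disj: "verts t' \<inter> verts t'' = {}" using A B AB(4) by simp
    have dist': "distinct (preorder t')" "distinct (preorder t'')"
      using dist distinct_grafts_iff[OF g] by auto
    have "preorder t' \<noteq> []" "preorder t'' \<noteq> []" by (cases t'; simp) (cases t''; simp)
    then have len: "length (preorder t') < length (preorder t)" "length (preorder t'') < length (preorder t)"
      using length_preorder_grafts[OF g] by auto
    have "binary_tubing t' (tubing_restrict \<tau> t')" "binary_tubing t'' (tubing_restrict \<tau> t'')"
      using binary_tubing_restrict[OF bt] connected_graph_grafts_iff[OF g disj] A B AB(1,2) by simp_all
    then obtain C' C'' where td: "tubing_diagram t' (tubing_restrict \<tau> t') C'"
      "tubing_diagram t'' (tubing_restrict \<tau> t'') C''"
      using less.hyps[OF len(1) _ dist'(1)] less.hyps[OF len(2) _ dist'(2)] by blast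
    obtain k where k: "k < length (rtips t'')" "x = rtips t'' ! k"
      using grafts_in_rtips[OF g] by (metis in_set_conv_nth)
    have "tubing_diagram t (insert (verts t) (tubing_restrict \<tau> t' \<union> tubing_restrict \<tau> t''))
        (insert_diagram (Suc k) C' C'')"
      using td disj by (rule tubing_diagram_graft) (use k g in auto)
    moreover have "insert (verts t) (tubing_restrict \<tau> t' \<union> tubing_restrict \<tau> t'') = \<tau>"
    proof
      show "insert (verts t) (tubing_restrict \<tau> t' \<union> tubing_restrict \<tau> t'') \<subseteq> \<tau>"
        using in\<tau> unfolding tubing_restrict_def by blast
      \<comment> \<open>The nesting condition rules out a tube that meets both parts without being
        everything, so the restrictions lose only the full vertex set.\<close>
      have "S = verts t \<or> S \<subseteq> A \<or> S \<subseteq> B" if "S \<in> \<tau>" for S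
        using tubes[OF that] lam[OF that AB(1)] lam[OF that AB(2)] AB(3) by blast
      then show "\<tau> \<subseteq> insert (verts t) (tubing_restrict \<tau> t' \<union> tubing_restrict \<tau> t'')"
        unfolding tubing_restrict_def A B by blast
    qed
    ultimately show ?thesis by metis
  qed
qed

section \<open>Renaming vertices, and trees with a given diagram\<close>

lemma rtips_map_nth:
  assumes "i \<in> {1..length (rtips t)}"
  shows "rtips (map_vtree f t) ! (i - 1) = map_prod f id (rtips t ! (i - 1))"
proof -
  have "i - 1 < length (rtips t)" using assms by auto
  then show ?thesis by (simp add: rtips_map)
qed

text \<open>The diagram depends on places only through their indices, and renaming keeps the order
  of the places.\<close>

lemma tubing_diagram_map:
  "tubing_diagram t \<tau> C \<Longrightarrow> inj_on f (verts t) \<Longrightarrow> tubing_diagram (map_vtree f t) ((`) f ` \<tau>) C"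
proof (induction rule: tubing_diagram.induct)
  case (tubing_diagram_leaf v)
  then show ?case using tubing_diagram.tubing_diagram_leaf[of "f v"] by simp
next
  case (tubing_diagram_graft t' \<tau>' C' t'' \<tau>'' C'' i t)
  note h = tubing_diagram_graft.hyps
  have V: "verts t = verts t' \<union> verts t''" using h(5) by (rule verts_grafts)
  have inj: "inj_on f (verts t')" "inj_on f (verts t'')"
    using tubing_diagram_graft.prems V inj_on_subset by blast+
  have "tubing_diagram (map_vtree f t)
      (insert (verts (map_vtree f t)) ((`) f ` \<tau>' \<union> (`) f ` \<tau>'')) (insert_diagram i C' C'')"
  proof (rule tubing_diagram.tubing_diagram_graft)
    show "tubing_diagram (map_vtree f t') ((`) f ` \<tau>') C'"
      "tubing_diagram (map_vtree f t'') ((`) f ` \<tau>'') C''"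
      using tubing_diagram_graft.IH inj by auto
    show "verts (map_vtree f t') \<inter> verts (map_vtree f t'') = {}"
      using inj_on_image_Int[OF tubing_diagram_graft.prems, of "verts t'" "verts t''"] V h(3)
      by (simp add: verts_map)
    show "i \<in> {1..length (rtips (map_vtree f t''))}" using h(4) by (simp add: rtips_map)
    show "grafts (map_vtree f t') (rtips (map_vtree f t'') ! (i - 1)) (map_vtree f t'') (map_vtree f t)"
      unfolding rtips_map_nth[OF h(4)] by (rule grafts_map[OF h(5)])
  qed
  then show ?case by (simp add: verts_map image_Un)
qed

text \<open>By \<open>insert_diagram_inj\<close> the diagram determines the index and both smaller
  diagrams. Induction gives a renaming of each part; they glue because the parts are disjoint on
  either side.\<close>

lemma tubing_diagram_unique:
  "tubing_diagram t \<tau> C \<Longrightarrow> tubing_diagram s \<sigma> C \<Longrightarrow>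
    \<exists>f. inj_on f (verts t) \<and> map_vtree f t = s \<and> (`) f ` \<tau> = \<sigma>"
proof (induction arbitrary: s \<sigma> rule: tubing_diagram.induct)
  case (tubing_diagram_leaf v)
  from tubing_diagram_leaf have "chord_diagram (length (preorder s)) {(1, 2)}"
    using tubing_diagram_diagram by blast
  then have "length (preorder s) = 1" using chord_diagram_card by fastforce
  from tubing_diagram_leaf show ?case
  proof cases
    case (tubing_diagram_leaf u)
    then show ?thesis by (intro exI[of _ "\<lambda>_. u"]) auto
  next
    case (tubing_diagram_graft t' \<tau>' C' t'' \<tau>'' C'' i)
    have "preorder t' \<noteq> []" "preorder t'' \<noteq> []" by (cases t'; simp) (cases t''; simp)
    then have "length (preorder t') > 0" "length (preorder t'') > 0" by simp_all
    then show ?thesis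
      \<comment> \<open>A grafted tree has at least two vertices, too many for a diagram with one
        chord.\<close>
      using \<open>length (preorder s) = 1\<close> length_preorder_grafts[OF tubing_diagram_graft(7)] by linarith
  qed
next
  case (tubing_diagram_graft t' \<tau>' C' t'' \<tau>'' C'' i t)
  note h = tubing_diagram_graft.hyps
  note d = tubing_diagram_diagram[OF h(1)] tubing_diagram_diagram[OF h(2)]
  have i: "i \<in> {1..2 * length (preorder t'') - 1}" using h(4) by (simp add: length_rtips)
  from tubing_diagram_graft.prems show ?case
  proof (cases rule: tubing_diagram.cases)
    case (tubing_diagram_leaf u)
    have "chord_diagram (length (preorder t') + length (preorder t'')) {(1, 2)}"
      using insert_diagram_chord_diagram(1)[of _ C' _ C'' i] d i tubing_diagram_leaf by metis
    then have "length (preorder t') + length (preorder t'') = 1" using chord_diagram_card by fastforce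
    moreover have "preorder t' \<noteq> []" "preorder t'' \<noteq> []" by (cases t'; simp) (cases t''; simp)
    then have "length (preorder t') > 0" "length (preorder t'') > 0" by simp_all
    ultimately show ?thesis by linarith
  next
    case (tubing_diagram_graft s' \<sigma>' B' s'' \<sigma>'' B'' j)
    note k = this
    note e = tubing_diagram_diagram[OF k(3)] tubing_diagram_diagram[OF k(4)]
    have j: "j \<in> {1..2 * length (preorder s'') - 1}" using k(6) by (simp add: length_rtips)
    have eq: "i = j" "C' = B'" "C'' = B''"
      using insert_diagram_inj[OF conjunct1[OF d(1)] conjunct2[OF d(1)] conjunct1[OF d(2)]
          conjunct2[OF d(2)] i conjunct1[OF e(1)] conjunct2[OF e(1)] conjunct1[OF e(2)]
          conjunct2[OF e(2)] j k(2)] by auto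
    obtain f' where f': "inj_on f' (verts t')" "map_vtree f' t' = s'" "(`) f' ` \<tau>' = \<sigma>'"
      using tubing_diagram_graft.IH(1) k(3) eq by blast
    obtain f'' where f'': "inj_on f'' (verts t'')" "map_vtree f'' t'' = s''" "(`) f'' ` \<tau>'' = \<sigma>''"
      using tubing_diagram_graft.IH(2) k(4) eq by blast
    define f where "f v = (if v \<in> verts t' then f' v else f'' v)" for v
    have f1: "f v = f' v" if "v \<in> verts t'" for v using that by (simp add: f_def)
    have f2: "f v = f'' v" if "v \<in> verts t''" for v using that h(3) by (auto simp: f_def)
    have m: "map_vtree f t' = s'" "map_vtree f t'' = s''"
      using map_vtree_cong_verts[of t' f f'] map_vtree_cong_verts[of t'' f f''] f1 f2 f' f'' by auto
    have V: "verts t = verts t' \<union> verts t''" using h(5) by (rule verts_grafts)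
    have "inj_on f (verts t') \<and> inj_on f (verts t'')"
      using f'(1) f''(1) inj_on_cong[of "verts t'" f f'] inj_on_cong[of "verts t''" f f''] f1 f2 by blast
    moreover have "f ` verts t' \<inter> f ` verts t'' = {}" using k(5) m verts_map by metis
    ultimately have inj: "inj_on f (verts t)" unfolding V inj_on_Un by blast
    have "grafts s' (rtips s'' ! (j - 1)) s'' (map_vtree f t)"
      using grafts_map[OF h(5), of f] rtips_map_nth[OF h(4), of f] unfolding m eq by simp
    then have ms: "map_vtree f t = s"
      using attach_eq_of_grafts[OF _ tubing_diagram_distinct[OF k(4)]] k(7) by metis
    have "(`) f ` \<tau>' = (`) f' ` \<tau>'"
      using tubing_diagram_tubes[OF h(1)] f1 by (intro image_cong) auto
    moreover have "(`) f ` \<tau>'' = (`) f'' ` \<tau>''"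
      using tubing_diagram_tubes[OF h(2)] f2 by (intro image_cong) auto
    ultimately have "(`) f ` insert (verts t) (\<tau>' \<union> \<tau>'') = \<sigma>"
      using f'(3) f''(3) k(1) ms by (simp add: image_Un verts_map[symmetric])
    then show ?thesis using inj ms by blast
  qed
qed

text \<open>Names are consecutive numbers from a free offset \<open>k\<close>, so that the trees
  from the two induction hypotheses can be given adjacent, hence disjoint, blocks of names.\<close>

lemma tubing_diagram_exists:
  "chord_diagram n C \<Longrightarrow> connected_diagram C \<Longrightarrow>
    \<exists>t \<tau>. tubing_diagram t \<tau> C \<and> verts t = {k..<k + n}" for k :: nat
proof (induction n arbitrary: C k rule: less_induct)
  case (less N)
  show ?case
  proof (cases "N \<ge> 2")
    case False
    then have "N = 1" using connected_diagram_size_pos[OF less.prems] by simp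
    then have "C = {(1, 2)}" using less.prems chord_diagram_one by blast
    then have "tubing_diagram (Node k []) {{k}} C \<and> verts (Node k []) = {k..<k + N}"
      using tubing_diagram_leaf[of k] \<open>N = 1\<close> by auto
    then show ?thesis by blast
  next
    case True
    obtain i m n C' C'' where C: "C = insert_diagram i C' C''" "m + n = N" "i \<in> {1..2 * n - 1}"
      and C': "chord_diagram m C'" "connected_diagram C'"
      and C'': "chord_diagram n C''" "connected_diagram C''"
      using insert_diagram_surj[OF less.prems True] .
    have mn: "m < N" "n < N"
      using C(2) connected_diagram_size_pos[OF C'] connected_diagram_size_pos[OF C''] by auto
    obtain t' \<tau>' where t': "tubing_diagram t' \<tau>' C'" "verts t' = {k..<k + m}"
      using less.IH[OF mn(1) C'] by blast
    obtain t'' \<tau>'' where t'': "tubing_diagram t'' \<tau>'' C''" "verts t'' = {k + m..<k + m + n}"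
      using less.IH[OF mn(2) C''] by blast
    have "length (preorder t'') = n"
      using card_verts[OF tubing_diagram_distinct[OF t''(1)]] t''(2) by simp
    then have i: "i \<in> {1..length (rtips t'')}" using C(3) by (simp add: length_rtips)
    then have "rtips t'' ! (i - 1) \<in> set (rtips t'')" by (intro nth_mem) auto
    then have g: "grafts t' (rtips t'' ! (i - 1)) t'' (attach t' (rtips t'' ! (i - 1)) t'')"
      using grafts_attach tubing_diagram_distinct[OF t''(1)] by blast
    have "verts t' \<inter> verts t'' = {}" using t' t'' by auto
    note td = tubing_diagram_graft[OF t'(1) t''(1) this i g]
    moreover have "verts (attach t' (rtips t'' ! (i - 1)) t'') = {k..<k + N}"
      using verts_grafts[OF g] t' t'' C(2) by auto
    ultimately show ?thesis unfolding C(1) by blast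
  qed
qed

section \<open>Canonical names\<close>

fun shape :: "'v vtree \<Rightarrow> plane_tree" where
  "shape (Node v ts) = Root (map shape ts)"

lemma shape_map: "shape (map_vtree f t) = shape t"
  by (induction t) auto

lemma shape_named_from:
  "shape (named_from p t) = t"
  "map shape (named_forest p j ts) = ts"
  by (induction p t and p j ts rule: named_from_named_forest.induct) auto

text \<open>Names extend the name of the parent, and different children continue it with different
  positions; this is why canonical names are distinct.\<close>

lemma verts_named_from:
  "v \<in> verts (named_from p t) \<Longrightarrow> \<exists>q. v = p @ q"
  "s \<in> set (named_forest p j ts) \<Longrightarrow> v \<in> verts s \<Longrightarrow> \<exists>k q. j \<le> k \<and> v = p @ k # q"
proof (induction p t and p j ts arbitrary: v and s v rule: named_from_named_forest.induct)
  case (1 p ts)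
  then show ?case by fastforce
next
  case (3 p j t ts)
  show ?case
  proof (cases "s = named_from (p @ [j]) t")
    case True
    then show ?thesis using 3(1)[of v] 3(4) by auto
  next
    case False
    then show ?thesis using 3(2)[of s v] 3(3,4) by (auto intro: Suc_leD)
  qed
qed auto

lemma distinct_named_from:
  "distinct (preorder (named_from p t))"
  "distinct (concat (map preorder (named_forest p j ts)))"
proof (induction p t and p j ts rule: named_from_named_forest.induct)
  case (1 p ts)
  have "p \<notin> verts s" if "s \<in> set (named_forest p 0 ts)" for s
    using verts_named_from(2)[OF that, of p] by auto
  then show ?case using 1 by auto
next
  case (3 p j t ts)
  have "v \<notin> verts s" if "v \<in> verts (named_from (p @ [j]) t)" "s \<in> set (named_forest p (Suc j) ts)" for v s
    using verts_named_from(1)[OF that(1)] verts_named_from(2)[OF that(2), of v] by auto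
  then show ?case using 3 by auto
qed auto

lemma length_preorder_shape: "shape t = shape s \<Longrightarrow> length (preorder t) = length (preorder s)"
proof (induction t arbitrary: s)
  case (Node v ts)
  obtain u ss where s: "s = Node u ss" by (cases s)
  then have "list_all2 (\<lambda>t s. length (preorder t) = length (preorder s)) ts ss"
    using Node by (auto simp: list_all2_conv_all_nth dest: map_eq_imp_length_eq)
      (metis map_eq_imp_length_eq nth_map nth_mem)
  then have "map (length \<circ> preorder) ts = map (length \<circ> preorder) ss"
    by (induction rule: list_all2_induct) auto
  then show ?case using s by (simp add: length_concat o_def)
qed

lemma map_vtree_eqI:
  "shape t = shape s \<Longrightarrow> map f (preorder t) = preorder s \<Longrightarrow> map_vtree f t = s"
proof (induction t arbitrary: s)
  case (Node v ts)
  obtain u ss where s: "s = Node u ss" by (cases s)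
  have "map shape ts = map shape ss" "map f (concat (map preorder ts)) = concat (map preorder ss)"
    using Node.prems s by auto
  then have "map (map_vtree f) ts = ss" using Node.IH
  proof (induction ts arbitrary: ss)
    case (Cons t ts)
    obtain r rs where ss: "ss = r # rs" using Cons.prems(1) by (cases ss) auto
    have sh: "shape t = shape r" "map shape ts = map shape rs" using Cons.prems(1) ss by auto
    \<comment> \<open>Equal shapes have equally long preorder lists, so the concatenated lists split
      at the same point.\<close>
    have "map f (preorder t) = preorder r \<and> map f (concat (map preorder ts)) = concat (map preorder rs)"
      using Cons.prems(2) length_preorder_shape[OF sh(1)] by (simp add: ss)
    then show ?case using Cons sh ss by auto
  qed auto
  then show ?case using s Node.prems by simp
qed

text \<open>The renaming matches the two preorder lists entry by entry.\<close>

lemma renaming_to_named: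
  assumes "distinct (preorder t)"
  obtains f where "inj_on f (verts t)" "map_vtree f t = named (shape t)"
proof -
  let ?s = "named (shape t)"
  have sh: "shape t = shape ?s" by (simp add: named_def shape_named_from)
  then have len: "length (preorder t) = length (preorder ?s)" by (rule length_preorder_shape)
  define f where "f v = the (map_of (zip (preorder t) (preorder ?s)) v)" for v
  have "map f (preorder t) = preorder ?s"
    using len assms by (intro nth_equalityI) (auto simp: f_def map_of_zip_nth)
  moreover have "distinct (preorder ?s)" by (simp add: named_def distinct_named_from)
  ultimately have "inj_on f (verts t)" by (metis distinct_map set_preorder)
  then show thesis using that map_vtree_eqI[OF sh] \<open>map f (preorder t) = preorder ?s\<close> by blast
qed

theorem theorem5p16:
  fixes n :: nat
  shows "bij_betw (\<lambda>(t, \<tau>). theta t \<tau>)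
    {(t, \<tau>). card (verts (named t)) = n \<and> binary_tubing (named t) \<tau>}
    {C. chord_diagram n C \<and> connected_diagram C}"
proof -
  let ?P = "{(t, \<tau>). card (verts (named t)) = n \<and> binary_tubing (named t) \<tau>}"
  have dist: "distinct (preorder (named t))" for t by (simp add: named_def distinct_named_from)
  have td: "tubing_diagram (named t) \<tau> (theta t \<tau>)" if "binary_tubing (named t) \<tau>" for t \<tau>
    using binary_tubing_has_diagram[OF that dist] tubing_diagram_theta unfolding theta_def by blast
  have "inj_on (\<lambda>(t, \<tau>). theta t \<tau>) ?P"
  proof (rule inj_onI, clarify)
    fix t \<tau> s \<sigma>
    assume bt: "binary_tubing (named t) \<tau>" "binary_tubing (named s) \<sigma>" and eq: "theta t \<tau> = theta s \<sigma>"
    obtain f where f: "map_vtree f (named t) = named s" "(`) f ` \<tau> = \<sigma>"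
      using tubing_diagram_unique[OF td[OF bt(1)]] td[OF bt(2)] eq by metis
    \<comment> \<open>Renaming does not change the shape, and the shape of \<open>named t\<close> is
      \<open>t\<close>. Then \<open>f\<close> maps the preorder list of \<open>named t\<close> to
      itself, so it fixes every vertex and every tube.\<close>
    have "t = s" using arg_cong[OF f(1), of shape] by (simp add: shape_map named_def shape_named_from)
    then have "map f (preorder (named t)) = preorder (named t)" using f(1) preorder_map by metis
    then have "f v = v" if "v \<in> verts (named t)" for v
      using that by (metis map_eq_conv map_ident set_preorder)
    then have "f ` S = S" if "S \<in> \<tau>" for S using tubing_diagram_tubes[OF td[OF bt(1)] that] by force
    then show "t = s \<and> \<tau> = \<sigma>" using f(2) \<open>t = s\<close> by auto
  qed
  moreover have "(\<lambda>(t, \<tau>). theta t \<tau>) ` ?P = {C. chord_diagram n C \<and> connected_diagram C}"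
  proof (intro equalityI subsetI)
    fix C assume "C \<in> (\<lambda>(t, \<tau>). theta t \<tau>) ` ?P"
    then show "C \<in> {C. chord_diagram n C \<and> connected_diagram C}"
      using tubing_diagram_diagram[OF td] card_verts[OF dist] by auto
  next
    fix C assume "C \<in> {C. chord_diagram n C \<and> connected_diagram C}"
    then obtain t :: "nat vtree" and \<tau> where t: "tubing_diagram t \<tau> C" "verts t = {0..<0 + n}"
      using tubing_diagram_exists[of n C 0] by blast
    \<comment> \<open>The tree just obtained has numbers as names; it is carried over to the
      canonical ones with its diagram unchanged.\<close>
    obtain f where f: "inj_on f (verts t)" "map_vtree f t = named (shape t)"
      using renaming_to_named[OF tubing_diagram_distinct[OF t(1)]] .
    have *: "tubing_diagram (named (shape t)) ((`) f ` \<tau>) C"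
      using tubing_diagram_map[OF t(1) f(1)] f(2) by simp
    have "card (verts (named (shape t))) = n"
      using f t(2) by (metis verts_map card_image card_atLeastLessThan add_0 diff_zero)
    then have "(shape t, (`) f ` \<tau>) \<in> ?P" using tubing_diagram_binary_tubing[OF *] by simp
    moreover have "theta (shape t) ((`) f ` \<tau>) = C" unfolding theta_def using * by (rule tubing_diagram_theta)
    ultimately show "C \<in> (\<lambda>(t, \<tau>). theta t \<tau>) ` ?P" by force
  qed
  ultimately show ?thesis unfolding bij_betw_def by blast
qed

end
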